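(* For every $\theta\in\mathscr{H}$, $$e^{D_\theta^{*}}1(w)=\exp\Big\{\int_0^1\dot\theta(t)\,dw(t)-\frac12\int_0^1\dot\theta(t)^2\,dt\Big\},\qquad w\in\mathscr{W}.$$ Furthermore, $$E\big[e^{D_\theta}F\big]=E\big[F\cdot e^{D_\theta^{*}}1\big]\qquad\text{for all }F\in\mathbf{P}.$$
   Context: $(\mathscr{W},\mathscr{B}(\mathscr{W}),\gamma)$ is the Wiener space: $\mathscr{W}$ is the set of continuous paths $w:[0,1]\to\mathbb{R}$ with $w(0)=0$, with the $\sigma$-field generated by the topology of uniform convergence, and $\gamma$ is Wiener measure; $E$ is expectation under $\gamma$. $\mathscr{H}\subset\mathscr{W}$ is the Cameron-Martin space of absolutely continuous $h$ with square-integrable derivative $\dot h$, with inner product $\langle h_1,h_2\rangle_{\mathscr{H}}=\int_0^1\dot h_1(t)\dot h_2(t)\,dt$. For $h\in\mathscr{H}$, $[h](w):=\int_0^1\dot h(t)\,dw(t)$ (Wiener integral), with the convention $[h](w+\theta)=[h](w)+\langle h,\theta\rangle_{\mathscr{H}}$ for $\theta\in\mathscr{H}$. $\mathbf{P}$ is the algebra of polynomial functionals $F(w)=p([h_1](w),\dots,[h_n](w))$, with $n\in\mathbb{N}$, $h_i\in\mathscr{H}$, $p$ a real polynomial in $n$ variables. For $\theta\in\mathscr{H}$, $D_\theta F(w)=\lim_{\varepsilon\to0}\frac1\varepsilon\{F(w+\varepsilon\theta)-F(w)\}$ and $D_\theta^{*}F(w):=-D_\theta F(w)+[\theta](w)F(w)$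 for $F\in\mathbf{P}$. The exponentials are $e^{D_\theta}F:=\sum_{n\ge0}\frac1{n!}D_\theta^nF$ for $F\in\mathbf{P}$ (a finite sum), and the formal series $e^{D_\theta^{*}}:=\sum_{n\ge0}\frac1{n!}(D_\theta^{*})^n$. *)

theory Defs
  imports "HOL-Probability.Probability"
begin

section \<open>The path space\<close>

text \<open>
  A path on \<open>[0,1]\<close> is represented by its extension by \<open>0\<close> to the real line, so that every path
  has exactly one representative; nothing is required of the extension at the endpoint \<open>1\<close>.
\<close>

typedef wpath =
  "{w :: real \<Rightarrow> real. continuous_on {0..1} w \<and> w 0 = 0 \<and> (\<forall>t. t \<notin> {0..1} \<longrightarrow> w t = 0)}"
  morphisms ev Abs_wpath
  by (rule exI[of _ "\<lambda>_. 0"]) auto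

setup_lifting type_definition_wpath

lemma ev_continuous_on: "continuous_on {0..1} (ev w)"
  and ev_0: "ev w 0 = 0"
  and ev_outside: "t \<notin> {0..1} \<Longrightarrow> ev w t = 0"
  using ev[of w] by auto

instantiation wpath :: real_vector
begin

lift_definition zero_wpath :: wpath is "\<lambda>_. 0"
  by auto

lift_definition plus_wpath :: "wpath \<Rightarrow> wpath \<Rightarrow> wpath" is "\<lambda>v w t. v t + w t"
  by (auto intro: continuous_on_add)

lift_definition minus_wpath :: "wpath \<Rightarrow> wpath \<Rightarrow> wpath" is "\<lambda>v w t. v t - w t"
  by (auto intro: continuous_on_diff)

lift_definition uminus_wpath :: "wpath \<Rightarrow> wpath" is "\<lambda>w t. - w t"
  by (auto intro: continuous_on_minus)

lift_definition scaleR_wpath :: "real \<Rightarrow> wpath \<Rightarrow> wpath" is "\<lambda>c w t. c * w t"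
  by (auto intro: continuous_on_mult_left)

instance
  by standard (transfer, auto simp: algebra_simps)+

end

lemmas ev_zero [simp] = zero_wpath.rep_eq [THEN fun_cong]
  and ev_plus [simp] = plus_wpath.rep_eq [THEN fun_cong]
  and ev_minus [simp] = minus_wpath.rep_eq [THEN fun_cong]
  and ev_uminus [simp] = uminus_wpath.rep_eq [THEN fun_cong]
  and ev_scaleR [simp] = scaleR_wpath.rep_eq [THEN fun_cong]

instantiation wpath :: real_normed_vector
begin

definition norm_wpath :: "wpath \<Rightarrow> real"
  where "norm_wpath w = (SUP t\<in>{0..1}. \<bar>ev w t\<bar>)"

definition sgn_wpath :: "wpath \<Rightarrow> wpath"
  where "sgn_wpath w = inverse (norm w) *\<^sub>R w"

definition dist_wpath :: "wpath \<Rightarrow> wpath \<Rightarrow> real"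
  where "dist_wpath v w = norm (v - w)"

definition uniformity_wpath :: "(wpath \<times> wpath) filter"
  where "uniformity_wpath = (INF e\<in>{0<..}. principal {(v, w). dist v w < e})"

definition open_wpath :: "wpath set \<Rightarrow> bool"
  where "open_wpath S \<longleftrightarrow> (\<forall>v\<in>S. \<forall>\<^sub>F (v', w) in uniformity. v' = v \<longrightarrow> w \<in> S)"

lemma bdd_above_ev: "bdd_above ((\<lambda>t. \<bar>ev w t\<bar>) ` {0..1})"
proof -
  have "compact ((\<lambda>t. \<bar>ev w t\<bar>) ` {0..1})"
    by (intro compact_continuous_image continuous_intros ev_continuous_on) auto
  then show ?thesis
    by (intro bounded_imp_bdd_above compact_imp_bounded)
qed

lemma abs_ev_le_norm: "\<bar>ev w t\<bar> \<le> norm w"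
proof (cases "t \<in> {0..1}")
  case True
  then show ?thesis
    unfolding norm_wpath_def by (intro cSUP_upper bdd_above_ev)
next
  case False
  have "\<bar>ev w 0\<bar> \<le> norm w"
    unfolding norm_wpath_def by (intro cSUP_upper bdd_above_ev) auto
  then show ?thesis
    using False by (simp add: ev_0 ev_outside)
qed

lemma norm_wpath_le: "(\<And>t. t \<in> {0..1} \<Longrightarrow> \<bar>ev w t\<bar> \<le> b) \<Longrightarrow> norm w \<le> b"
  unfolding norm_wpath_def by (intro cSUP_least) auto

instance
proof
  fix v w :: wpath and c :: real and S :: "wpath set"
  show "dist v w = norm (v - w)"
    by (rule dist_wpath_def)
  show "sgn w = inverse (norm w) *\<^sub>R w"
    by (rule sgn_wpath_def)
  show "uniformity = (INF e\<in>{0<..}. principal {(v :: wpath, w). dist v w < e})"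
    by (rule uniformity_wpath_def)
  show "open S \<longleftrightarrow> (\<forall>v\<in>S. \<forall>\<^sub>F (v', w) in uniformity. v' = v \<longrightarrow> w \<in> S)"
    by (rule open_wpath_def)
  show "norm w = 0 \<longleftrightarrow> w = 0"
  proof
    assume "norm w = 0"
    then have "ev w t = 0" for t
      using abs_ev_le_norm[of w t] by simp
    then show "w = 0"
      by (simp add: ev_inject[symmetric] fun_eq_iff)
  qed (simp add: norm_wpath_def)
  show "norm (v + w) \<le> norm v + norm w"
  proof (rule norm_wpath_le)
    fix t
    show "\<bar>ev (v + w) t\<bar> \<le> norm v + norm w"
      using abs_ev_le_norm[of v t] abs_ev_le_norm[of w t] by simp
  qed
  have le: "norm (c *\<^sub>R w) \<le> \<bar>c\<bar> * norm w" for c and w :: wpath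
    by (rule norm_wpath_le) (simp add: abs_mult abs_ev_le_norm mult_left_mono)
  show "norm (c *\<^sub>R w) = \<bar>c\<bar> * norm w"
  proof (cases "c = 0")
    case True
    then show ?thesis by (simp add: norm_wpath_def)
  next
    case False
    have "norm w \<le> \<bar>inverse c\<bar> * norm (c *\<^sub>R w)"
      using le[of "inverse c" "c *\<^sub>R w"] False by simp
    then have "\<bar>c\<bar> * norm w \<le> norm (c *\<^sub>R w)"
      using False by (simp add: field_simps)
    with le[of c w] show ?thesis by simp
  qed
qed

end


section \<open>Wiener measure\<close>

definition wiener_measure :: "wpath measure \<Rightarrow> bool"
  where "wiener_measure \<gamma> \<longleftrightarrow>
    prob_space \<gamma> \<and> sets \<gamma> = sets borel \<and>
    (\<forall>s t. 0 \<le> s \<and> s < t \<and> t \<le> 1 \<longrightarrow>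
       distributed \<gamma> lborel (\<lambda>w. ev w t - ev w s) (normal_density 0 (sqrt (t - s)))) \<and>
    (\<forall>n t. 0 \<le> t 0 \<and> (\<forall>i<n. t i < t (Suc i)) \<and> t n \<le> 1 \<longrightarrow>
       prob_space.indep_vars \<gamma> (\<lambda>_. borel) (\<lambda>i w. ev w (t (Suc i)) - ev w (t i)) {..<n})"


section \<open>The Cameron-Martin space\<close>

definition absolutely_continuous_on_01 :: "(real \<Rightarrow> real) \<Rightarrow> bool"
  where "absolutely_continuous_on_01 f \<longleftrightarrow>
    (\<forall>\<epsilon>>0. \<exists>\<delta>>0. \<forall>n a b.
       (\<forall>i<n. 0 \<le> a i \<and> a i \<le> b i \<and> b i \<le> (1::real)) \<and>
       disjoint_family_on (\<lambda>i. {a i<..<b i}) {..<n} \<and>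
       (\<Sum>i<(n::nat). b i - a i) < \<delta> \<longrightarrow>
       (\<Sum>i<n. \<bar>f (b i) - f (a i)\<bar>) < \<epsilon>)"

text \<open>
  The derivative of a path is \<^const>\<open>deriv\<close>, whose (arbitrary) values at points of
  non-differentiability matter only on a null set: by Lebesgue's theorem an absolutely continuous
  function is differentiable almost everywhere, with measurable derivative. These two consequences
  are listed below as well, since that theorem is not in the library; they do not change the set.
\<close>

definition cameron_martin :: "wpath set"
  where "cameron_martin = {h.
    absolutely_continuous_on_01 (ev h) \<and>
    (AE t in lebesgue_on {0..1}. ev h differentiable (at t)) \<and>
    deriv (ev h) \<in> borel_measurable (lebesgue_on {0..1}) \<and>
    integrable (lebesgue_on {0..1}) (\<lambda>t. (deriv (ev h) t)\<^sup>2)}"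

definition cm_inner :: "wpath \<Rightarrow> wpath \<Rightarrow> real"
  where "cm_inner h k = (\<integral>t. deriv (ev h) t * deriv (ev k) t \<partial>lebesgue_on {0..1})"


section \<open>The Wiener integral\<close>

definition partition_01 :: "nat \<Rightarrow> (nat \<Rightarrow> real) \<Rightarrow> bool"
  where "partition_01 n t \<longleftrightarrow> 0 \<le> t 0 \<and> (\<forall>i<n. t i < t (Suc i)) \<and> t n \<le> 1"

definition step_fun :: "nat \<Rightarrow> (nat \<Rightarrow> real) \<Rightarrow> (nat \<Rightarrow> real) \<Rightarrow> real \<Rightarrow> real"
  where "step_fun n t a s = (\<Sum>i<n. a i * indicator {t i<..t (Suc i)} s)"

definition step_integral :: "nat \<Rightarrow> (nat \<Rightarrow> real) \<Rightarrow> (nat \<Rightarrow> real) \<Rightarrow> wpath \<Rightarrow> real"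
  where "step_integral n t a w = (\<Sum>i<n. a i * (ev w (t (Suc i)) - ev w (t i)))"

text \<open>
  \<open>X\<close> is a version of the Wiener integral \<open>\<integral> f dw\<close>: it is the limit in \<open>L\<^sup>2(\<gamma>)\<close> of the
  integrals of step functions that converge to \<open>f\<close> in \<open>L\<^sup>2[0,1]\<close>. By the isometry, the choice of
  the approximating sequence affects \<open>X\<close> only on a null set.
\<close>

definition is_wiener_integral ::
    "wpath measure \<Rightarrow> (real \<Rightarrow> real) \<Rightarrow> (wpath \<Rightarrow> real) \<Rightarrow> bool"
  where "is_wiener_integral \<gamma> f X \<longleftrightarrow>
    X \<in> borel_measurable (completion \<gamma>) \<and>
    (\<exists>n t a.
      (\<forall>k. partition_01 (n k) (t k)) \<and>
      (\<lambda>k. \<integral>\<^sup>+s. ennreal ((f s - step_fun (n k) (t k) (a k) s)\<^sup>2) \<partial>lebesgue_on {0..1})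
        \<longlonglongrightarrow> 0 \<and>
      (\<lambda>k. \<integral>\<^sup>+w. ennreal ((X w - step_integral (n k) (t k) (a k) w)\<^sup>2) \<partial>completion \<gamma>)
        \<longlonglongrightarrow> 0)"

text \<open>
  \<open>I h w\<close> stands for \<open>[h](w)\<close>. The Wiener integral is only determined almost surely, and the
  convention \<open>[h](w + \<theta>) = [h](w) + \<langle>h, \<theta>\<rangle>\<close>, for all paths \<open>w\<close> and all \<open>\<theta>\<close> in the
  Cameron-Martin space, is a requirement on the chosen versions.

  Such versions exist: the step integrals of the dyadic averages of the derivative of \<open>h\<close> converge
  on a linear subspace of full measure containing the Cameron-Martin space; take their limit there
  and extend it linearly. Measurability can only be asked for with respect to the completion of
  \<open>\<gamma>\<close>: if the derivative of \<open>h\<close> is not a.e. equal to a function of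
  bounded variation, then \<open>\<langle>h, \<cdot>\<rangle>\<close> is not continuous
  for the uniform topology, and by a Baire category argument no Borel function on the path space
  satisfies the convention at every \<open>w\<close>.
\<close>

definition wiener_bracket :: "wpath measure \<Rightarrow> (wpath \<Rightarrow> wpath \<Rightarrow> real) \<Rightarrow> bool"
  where "wiener_bracket \<gamma> I \<longleftrightarrow>
    (\<forall>h\<in>cameron_martin. is_wiener_integral \<gamma> (deriv (ev h)) (I h)) \<and>
    (\<forall>h\<in>cameron_martin. \<forall>\<theta>\<in>cameron_martin. \<forall>w. I h (w + \<theta>) = I h w + cm_inner h \<theta>)"


section \<open>Polynomial functionals and the operators\<close>

text \<open>A monomial is given by its exponents \<open>m 0, \<dots>, m (n - 1)\<close>; further values of \<open>m\<close> are irrelevant.\<close>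

definition real_polynomials :: "nat \<Rightarrow> ((nat \<Rightarrow> real) \<Rightarrow> real) set"
  where "real_polynomials n =
    {\<lambda>x. \<Sum>m\<in>M. c m * (\<Prod>i<n. x i ^ m i) | (M :: (nat \<Rightarrow> nat) set) c. finite M}"

definition polynomial_functionals :: "(wpath \<Rightarrow> wpath \<Rightarrow> real) \<Rightarrow> (wpath \<Rightarrow> real) set"
  where "polynomial_functionals I =
    {\<lambda>w. p (\<lambda>i. I (h i) w) | n p h. p \<in> real_polynomials n \<and> (\<forall>i<n. h i \<in> cameron_martin)}"

definition D :: "wpath \<Rightarrow> (wpath \<Rightarrow> real) \<Rightarrow> wpath \<Rightarrow> real"
  where "D \<theta> F w = Lim (at 0) (\<lambda>\<epsilon>::real. 1 / \<epsilon> * (F (w + \<epsilon> *\<^sub>R \<theta>) - F w))"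

definition Dstar ::
    "(wpath \<Rightarrow> wpath \<Rightarrow> real) \<Rightarrow> wpath \<Rightarrow> (wpath \<Rightarrow> real) \<Rightarrow> wpath \<Rightarrow> real"
  where "Dstar I \<theta> F w = - D \<theta> F w + I \<theta> w * F w"

text \<open>Both exponential series are taken pointwise; the first is a finite sum on polynomial functionals.\<close>

definition exp_D :: "wpath \<Rightarrow> (wpath \<Rightarrow> real) \<Rightarrow> wpath \<Rightarrow> real"
  where "exp_D \<theta> F w = (\<Sum>n. 1 / fact n * (D \<theta> ^^ n) F w)"

definition exp_Dstar ::
    "(wpath \<Rightarrow> wpath \<Rightarrow> real) \<Rightarrow> wpath \<Rightarrow> (wpath \<Rightarrow> real) \<Rightarrow> wpath \<Rightarrow> real"
  where "exp_Dstar I \<theta> F w = (\<Sum>n. 1 / fact n * (Dstar I \<theta> ^^ n) F w)"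

end

theory Submission
  imports Defs "HOL-Complex_Analysis.Cauchy_Integral_Formula"
begin

text \<open>
  On the line \<open>w + s \<theta>\<close> a polynomial functional is a polynomial in \<open>s\<close>, so \<open>e\<^bsup>D\<^esup>\<close> is
  translation by \<open>\<theta>\<close> (Taylor), and the iterates of \<open>D*\<close> on \<open>1\<close> are Hermite polynomials in
  \<open>[\<theta>](w)\<close> with variance \<open>v = |\<theta>|\<^sup>2\<close>, whose generating function is the stated exponential.

  The second claim is then the Cameron-Martin formula for monomials. For exponentials
  \<open>F = exp Z\<close>, with \<open>Z\<close> a linear combination of Wiener integrals, it is a computation with
  Gaussian moment generating functions. Replacing \<open>Z\<close> by \<open>Z + s [h]\<close>, both sides become power
  series in \<open>s\<close>; comparing coefficients multiplies the integrand by a power of \<open>[h]\<close>, so the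
  monomials follow by induction on the number of factors, and at the end \<open>Z = 0\<close>.
\<close>

section \<open>Hermite polynomials and the exponential series\<close>

text \<open>Probabilists' Hermite polynomials rescaled to variance \<open>v\<close>: for real
  \<open>v > 0\<close> they are v^(n/2) He_n(x / sqrt v), and \<open>v = 0\<close> gives plain
  powers. The type is general because the generating function is obtained over the complex numbers
  and used over the reals.\<close>

fun hermite :: "'a::real_normed_field \<Rightarrow> nat \<Rightarrow> 'a \<Rightarrow> 'a" where
  "hermite v 0 x = 1"
| "hermite v (Suc 0) x = x"
| "hermite v (Suc (Suc n)) x = x * hermite v (Suc n) x - of_nat (Suc n) * v * hermite v n x"

text \<open>One recursion for all \<open>n\<close>: at \<open>n = 0\<close> the truncated index
  \<open>n - 1\<close> is harmless, since its factor \<open>of_nat n\<close> vanishes.\<close>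

lemma hermite_Suc: "hermite v (Suc n) x = x * hermite v n x - of_nat n * v * hermite v (n - 1) x"
  by (cases n) auto

text \<open>The Appell property. Differentiating the three-term recursion gives one
  \<open>hermite v (Suc n) x\<close> from the factor \<open>x\<close>; by \<open>hermite_Suc\<close>
  the other terms are \<open>of_nat (Suc n)\<close> further copies.\<close>

lemma hermite_has_field_derivative:
  "(hermite v n has_field_derivative of_nat n * hermite v (n - 1) x) (at x)"
proof (induction v n x rule: hermite.induct)
  case (3 v n x)
  have eq: "hermite v (Suc (Suc n)) =
      (\<lambda>x. x * hermite v (Suc n) x - of_nat (Suc n) * v * hermite v n x)"
    by (rule ext) simp
  show ?case
    unfolding eq
    by (rule derivative_eq_intros 3 refl)+ (simp add: hermite_Suc[of v n x] algebra_simps)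
qed (auto intro!: derivative_eq_intros simp: fun_eq_iff)

lemma hermite_of_real: "hermite (of_real v) n (of_real x) = of_real (hermite v n x)"
  by (induction v n x rule: hermite.induct) auto

text \<open>The entire function \<open>f\<close> is the generating function in the variable z; the
  series is its Taylor series at 0, evaluated at z = 1.\<close>

lemma hermite_sums_exp:
  fixes v x :: real
  shows "(\<lambda>n. hermite v n x / fact n) sums exp (x - v / 2)"
proof -
  define f where "f z = exp (complex_of_real x * z - complex_of_real v * z\<^sup>2 / 2)" for z
  have f': "(f has_field_derivative (of_real x - of_real v * z) * f z) (at z)" for z
    unfolding f_def by (auto intro!: derivative_eq_intros simp: algebra_simps)
  \<comment> \<open>Differentiating the exponential brings down x - v z, and the inner argument
    contributes -v; together they reproduce \<open>hermite_Suc\<close> at the point x - v z.\<close>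
  have "(deriv ^^ n) f = (\<lambda>z. hermite (of_real v) n (of_real x - of_real v * z) * f z)" for n
  proof (induction n)
    case (Suc n)
    have "((\<lambda>z. hermite (of_real v) n (of_real x - of_real v * z) * f z) has_field_derivative
        hermite (of_real v) (Suc n) (of_real x - of_real v * z) * f z) (at z)" for z
      by (rule derivative_eq_intros f' DERIV_chain2[OF hermite_has_field_derivative] refl)+
        (simp add: hermite_Suc algebra_simps)
    with Suc show ?case
      by (auto intro!: DERIV_imp_deriv)
  qed simp
  then have *: "(deriv ^^ n) f 0 = of_real (hermite v n x)" for n
    by (simp add: f_def hermite_of_real)
  \<comment> \<open>The radius only has to exceed 1, the point of evaluation.\<close>
  have "f holomorphic_on ball 0 2"
    unfolding f_def by (intro holomorphic_intros) auto
  from holomorphic_power_series[OF this, of 1]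
  have "(\<lambda>n. complex_of_real (hermite v n x / fact n)) sums f 1"
    by (simp add: *)
  also have "f 1 = of_real (exp (x - v / 2))"
    by (simp add: f_def exp_of_real[symmetric])
  finally show ?thesis
    by (simp only: sums_of_real_iff)
qed

section \<open>Differentiation along the lines w + s \<theta>\<close>

lemma D_eqI:
  "((\<lambda>e. 1 / e * (F (w + e *\<^sub>R \<theta>) - F w)) \<longlongrightarrow> L) (at 0) \<Longrightarrow> D \<theta> F w = L"
  unfolding D_def by (rule tendsto_Lim) auto

text \<open>Differentiating an iterate at one point uses its values nearby on the line, so the
  induction runs with \<open>s\<close> arbitrary.\<close>

lemma D_funpow_on_line:
  assumes "\<And>s. F (w + s *\<^sub>R \<theta>) = poly q s"
  shows "(D \<theta> ^^ n) F (w + s *\<^sub>R \<theta>) = poly ((pderiv ^^ n) q) s"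
proof (induction n arbitrary: s)
  case (Suc n)
  have "((\<lambda>e. 1 / e * (poly ((pderiv ^^ n) q) (s + e) - poly ((pderiv ^^ n) q) s)) \<longlongrightarrow>
      poly (pderiv ((pderiv ^^ n) q)) s) (at 0)"
    using poly_DERIV[of "(pderiv ^^ n) q" s] by (simp add: DERIV_def)
  moreover have "(D \<theta> ^^ n) F (w + s *\<^sub>R \<theta> + e *\<^sub>R \<theta>) = poly ((pderiv ^^ n) q) (s + e)" for e
    using Suc.IH[of "s + e"] by (simp add: scaleR_add_left add.assoc)
  ultimately have "D \<theta> ((D \<theta> ^^ n) F) (w + s *\<^sub>R \<theta>) = poly (pderiv ((pderiv ^^ n) q)) s"
    by (intro D_eqI) (simp add: Suc.IH)
  then show ?case
    by simp
qed (simp add: assms)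

text \<open>The n-th iterate at \<open>w\<close> is \<open>fact n\<close> times a coefficient of
  \<open>q\<close>; the factorial cancels, and the sum of all coefficients is
  \<open>poly q 1\<close>.\<close>

lemma exp_D_eq_translation:
  assumes "\<And>s. F (w + s *\<^sub>R \<theta>) = poly q s"
  shows "exp_D \<theta> F w = F (w + \<theta>)"
proof -
  have "(D \<theta> ^^ n) F w = fact n * coeff q n" for n
    using D_funpow_on_line[OF assms, of n 0]
    by (simp add: poly_0_coeff_0 coeff_higher_pderiv pochhammer_fact)
  then have "exp_D \<theta> F w = (\<Sum>n. coeff q n)"
    by (simp add: exp_D_def)
  also have "\<dots> = (\<Sum>n\<le>degree q. coeff q n)"
    by (rule suminf_finite) (auto simp: coeff_eq_0)
  also have "\<dots> = F (w + \<theta>)"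
    using assms[of 1] by (simp add: poly_altdef)
  finally show ?thesis .
qed

text \<open>On functions of x = \<open>I \<theta> w\<close> the operator acts as x - v d/dx, which
  raises the Hermite index by one, by the derivative formula and \<open>hermite_Suc\<close>.\<close>

lemma Dstar_funpow_1:
  assumes I: "\<And>w s. I \<theta> (w + s *\<^sub>R \<theta>) = I \<theta> w + s * v"
  shows "(Dstar I \<theta> ^^ n) (\<lambda>_. 1) w = hermite v n (I \<theta> w)"
proof (induction n arbitrary: w)
  case (Suc n)
  have "((\<lambda>s. hermite v n (I \<theta> w + s * v)) has_field_derivative
      of_nat n * hermite v (n - 1) (I \<theta> w + 0 * v) * v) (at 0)"
    by (rule DERIV_chain2[OF hermite_has_field_derivative]) (auto intro!: derivative_eq_intros)
  then have "((\<lambda>e. 1 / e * (hermite v n (I \<theta> w + e * v) - hermite v n (I \<theta> w))) \<longlongrightarrow>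
      of_nat n * hermite v (n - 1) (I \<theta> w) * v) (at 0)"
    by (simp add: DERIV_def)
  then have "D \<theta> ((Dstar I \<theta> ^^ n) (\<lambda>_. 1)) w = of_nat n * hermite v (n - 1) (I \<theta> w) * v"
    by (intro D_eqI) (simp add: Suc.IH I)
  then have "Dstar I \<theta> ((Dstar I \<theta> ^^ n) (\<lambda>_. 1)) w = hermite v (Suc n) (I \<theta> w)"
    unfolding Dstar_def[of I \<theta> "(Dstar I \<theta> ^^ n) (\<lambda>_. 1)"] hermite_Suc Suc.IH by simp
  then show ?case
    by simp
qed simp

section \<open>Comparing moments through exponential generating functions\<close>

text \<open>Expanding \<open>exp (s * X x)\<close> under the integral is justified by domination:
  every partial sum of the absolute series is at most
  \<open>\<bar>U x\<bar> * exp \<bar>s * X x\<bar>\<close>.\<close>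

lemma exponential_moments:
  fixes U X :: "'a \<Rightarrow> real"
  assumes [measurable]: "U \<in> borel_measurable M" "X \<in> borel_measurable M"
    and int: "\<And>s. integrable M (\<lambda>x. U x * exp (s * X x))"
  shows integrable_moment: "integrable M (\<lambda>x. U x * X x ^ n)"
    and moments_sums: "(\<lambda>n. (\<integral>x. U x * X x ^ n \<partial>M) / fact n * s ^ n) sums (\<integral>x. U x * exp (s * X x) \<partial>M)"
proof -
  \<comment> \<open>Integrability at both \<open>s\<close> and \<open>- s\<close> is what controls
    the absolute value in the exponent.\<close>
  have abs_int: "integrable M (\<lambda>x. \<bar>U x\<bar> * exp \<bar>s * X x\<bar>)" for s
  proof (rule Bochner_Integration.integrable_bound)
    show "integrable M (\<lambda>x. \<bar>U x * exp (s * X x)\<bar> + \<bar>U x * exp (- s * X x)\<bar>)"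
      by (intro Bochner_Integration.integrable_add integrable_abs int)
    have "exp \<bar>y\<bar> \<le> exp y + exp (- y)" for y :: real
      by (cases "0 \<le> y") auto
    then have "\<bar>u\<bar> * exp \<bar>y\<bar> \<le> \<bar>u\<bar> * exp y + \<bar>u\<bar> * exp (- y)" for u y :: real
      by (simp add: distrib_left[symmetric] mult_left_mono)
    from this[of "U _" "s * X _"]
    show "AE x in M. norm (\<bar>U x\<bar> * exp \<bar>s * X x\<bar>) \<le>
        norm (\<bar>U x * exp (s * X x)\<bar> + \<bar>U x * exp (- s * X x)\<bar>)"
      by (intro AE_I2) (simp add: abs_mult)
  qed measurable
  have exp_sums: "(\<lambda>n. \<bar>y\<bar> ^ n / fact n) sums exp \<bar>y\<bar>" for y :: real
    using exp_converges[of "\<bar>y\<bar>"] by (simp add: field_simps)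
  \<comment> \<open>Used twice: a singleton \<open>A\<close> bounds a single moment, an initial
    segment bounds the partial sums.\<close>
  have partial: "(\<Sum>i\<in>A. \<bar>y\<bar> ^ i / fact i) \<le> exp \<bar>y\<bar>" if "finite A" for A and y :: real
    using sum_le_suminf[of "\<lambda>n. \<bar>y\<bar> ^ n / fact n" A] exp_sums[of y] that
    by (auto simp: sums_iff)
  have int_moment: "integrable M (\<lambda>x. U x * X x ^ n)" for n
  proof (rule Bochner_Integration.integrable_bound)
    show "integrable M (\<lambda>x. fact n * (\<bar>U x\<bar> * exp \<bar>1 * X x\<bar>))"
      by (intro integrable_mult_right abs_int)
    have "\<bar>y\<bar> ^ n \<le> fact n * exp \<bar>y\<bar>" for y :: real
      using partial[of "{n}" y] by (simp add: field_simps)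
    then show "AE x in M. norm (U x * X x ^ n) \<le> norm (fact n * (\<bar>U x\<bar> * exp \<bar>1 * X x\<bar>))"
      by (intro AE_I2) (simp add: abs_mult power_abs mult.left_commute[of "fact n"] mult_left_mono)
  qed measurable
  then show "integrable M (\<lambda>x. U x * X x ^ n)" .
  define f where "f n x = s ^ n / fact n * (U x * X x ^ n)" for n x
  have norm_f: "norm (f n x) = \<bar>U x\<bar> * (\<bar>s * X x\<bar> ^ n / fact n)" for n x
    by (simp add: f_def abs_mult power_abs power_mult_distrib)
  have f_int: "integrable M (f n)" for n
    unfolding f_def by (intro integrable_mult_right int_moment)
  have f_sums: "(\<lambda>n. f n x) sums (U x * exp (s * X x))" for x
    using sums_mult[OF exp_converges[of "s * X x"], of "U x"]
    by (simp add: f_def field_simps power_mult_distrib)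
  have "(\<lambda>n. integral\<^sup>L M (f n)) sums (\<integral>x. (\<Sum>n. f n x) \<partial>M)"
  proof (rule sums_integral[OF f_int])
    show "AE x in M. summable (\<lambda>n. norm (f n x))"
      unfolding norm_f by (intro AE_I2 summable_mult sums_summable[OF exp_sums])
    show "summable (\<lambda>n. \<integral>x. norm (f n x) \<partial>M)"
    proof (rule summableI_nonneg_bounded)
      fix N
      have "(\<Sum>n<N. \<integral>x. norm (f n x) \<partial>M) = (\<integral>x. (\<Sum>n<N. norm (f n x)) \<partial>M)"
        by (intro Bochner_Integration.integral_sum[symmetric] integrable_norm f_int)
      also have "\<dots> \<le> (\<integral>x. \<bar>U x\<bar> * exp \<bar>s * X x\<bar> \<partial>M)"
      proof (rule integral_mono[OF _ abs_int])
        show "integrable M (\<lambda>x. \<Sum>n<N. norm (f n x))"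
          by (intro Bochner_Integration.integrable_sum integrable_norm f_int)
        show "(\<Sum>n<N. norm (f n x)) \<le> \<bar>U x\<bar> * exp \<bar>s * X x\<bar>" for x
          unfolding norm_f sum_distrib_left[symmetric] by (intro mult_left_mono partial) auto
      qed
      finally show "(\<Sum>n<N. \<integral>x. norm (f n x) \<partial>M) \<le> (\<integral>x. \<bar>U x\<bar> * exp \<bar>s * X x\<bar> \<partial>M)" .
    qed simp
  qed
  also have "(\<lambda>n. integral\<^sup>L M (f n)) = (\<lambda>n. (\<integral>x. U x * X x ^ n \<partial>M) / fact n * s ^ n)"
  proof
    fix n
    have "integral\<^sup>L M (f n) = (\<integral>x. s ^ n / fact n * (U x * X x ^ n) \<partial>M)"
      by (rule Bochner_Integration.integral_cong) (simp_all add: f_def)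
    then show "integral\<^sup>L M (f n) = (\<integral>x. U x * X x ^ n \<partial>M) / fact n * s ^ n"
      by (subst (asm) integral_mult_right_zero) (simp add: field_simps)
  qed
  also have "(\<lambda>x. \<Sum>n. f n x) = (\<lambda>x. U x * exp (s * X x))"
    using f_sums by (auto simp: sums_iff)
  finally show "(\<lambda>n. (\<integral>x. U x * X x ^ n \<partial>M) / fact n * s ^ n) sums (\<integral>x. U x * exp (s * X x) \<partial>M)" .
qed

text \<open>Uniqueness of power series coefficients: the two expansions agree for every real
  \<open>s\<close>, so their difference is a power series that sums to 0 everywhere.\<close>

lemma moments_eqI:
  fixes U X :: "'a \<Rightarrow> real" and V Y :: "'b \<Rightarrow> real"
  assumes [measurable]: "U \<in> borel_measurable M" "X \<in> borel_measurable M"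
      "V \<in> borel_measurable N" "Y \<in> borel_measurable N"
    and int: "\<And>s. integrable M (\<lambda>x. U x * exp (s * X x))"
      "\<And>s. integrable N (\<lambda>x. V x * exp (s * Y x))"
    and eq: "\<And>s. (\<integral>x. U x * exp (s * X x) \<partial>M) = (\<integral>x. V x * exp (s * Y x) \<partial>N)"
  shows "(\<integral>x. U x * X x ^ n \<partial>M) = (\<integral>x. V x * Y x ^ n \<partial>N)"
proof -
  define a where "a n = (\<integral>x. U x * X x ^ n \<partial>M) / fact n - (\<integral>x. V x * Y x ^ n \<partial>N) / fact n" for n
  have a: "(\<lambda>n. a n * (s - 0) ^ n) sums 0" for s
  proof -
    have "(\<lambda>n. (\<integral>x. U x * X x ^ n \<partial>M) / fact n * s ^ n - (\<integral>x. V x * Y x ^ n \<partial>N) / fact n * s ^ n) sums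
        ((\<integral>x. U x * exp (s * X x) \<partial>M) - (\<integral>x. V x * exp (s * Y x) \<partial>N))"
      by (intro sums_diff moments_sums assms)
    then show ?thesis
      by (simp only: a_def left_diff_distrib eq diff_self diff_zero)
  qed
  have "a n = 0"
  proof (rule ccontr)
    assume "a n \<noteq> 0"
    moreover have "a 0 = 0"
      using a[of 0] by simp
    ultimately have "n > 0"
      by (cases n) auto
    show False
    \<comment> \<open>A nonzero coefficient of positive index would make 0 an isolated zero of the
      zero function. Index 0 has been excluded by evaluating at \<open>s = 0\<close>.\<close>
    proof (rule powser_0_nonzero[where f = "\<lambda>_::real. 0::real", OF zero_less_one a refl \<open>a n \<noteq> 0\<close> \<open>n > 0\<close>])
      fix s :: real
      assume "0 < s" and *: "\<And>z. z \<in> cball (0::real) s - {0} \<Longrightarrow> (0::real) \<noteq> 0"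
      from *[of s] \<open>0 < s\<close> show False
        by simp
    qed
  qed
  then show ?thesis
    by (simp add: a_def)
qed

section \<open>Step functions\<close>

lemma step_fun_right: "(\<And>i. i < n \<Longrightarrow> t i < t (Suc i)) \<Longrightarrow> t n < s \<Longrightarrow> step_fun n t a s = 0"
proof (induction n)
  case (Suc n)
  have "t n < t (Suc n)" using Suc.prems by simp
  with Suc show ?case
    by (simp add: step_fun_def)
qed (simp add: step_fun_def)

text \<open>There are no cross terms: on the last interval, the function built from the earlier ones
  vanishes by \<open>step_fun_right\<close>.\<close>

lemma step_fun_squared:
  "(\<And>i. i < n \<Longrightarrow> t i < t (Suc i)) \<Longrightarrow>
    (step_fun n t a s)\<^sup>2 = (\<Sum>i<n. (a i)\<^sup>2 * indicator {t i<..t (Suc i)} s)"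
proof (induction n)
  case (Suc n)
  have "step_fun n t a s * indicator {t n<..t (Suc n)} s = 0"
    using step_fun_right[of n t s a] Suc.prems by (auto simp: indicator_def)
  moreover have "(step_fun (Suc n) t a s)\<^sup>2 = (step_fun n t a s)\<^sup>2 +
      2 * a n * (step_fun n t a s * indicator {t n<..t (Suc n)} s) +
      (a n)\<^sup>2 * indicator {t n<..t (Suc n)} s"
    by (simp add: step_fun_def power2_eq_square algebra_simps indicator_def)
  ultimately show ?case
    using Suc by simp
qed (simp add: step_fun_def)

lemma partition_01_bounds: "partition_01 n t \<Longrightarrow> i \<le> n \<Longrightarrow> 0 \<le> t i \<and> t i \<le> 1"
proof -
  assume p: "partition_01 n t" and i: "i \<le> n"
  have "t i \<le> t j" if "i \<le> j" "j \<le> n" for i j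
    using that
  proof (induction j rule: dec_induct)
    case (step j)
    moreover have "t j < t (Suc j)"
      using p step by (auto simp: partition_01_def)
    ultimately show ?case by simp
  qed simp
  from this[of 0 i] this[of i n] show ?thesis
    using p i by (auto simp: partition_01_def)
qed

text \<open>The value is the variance of \<open>step_integral n t a\<close> under Wiener measure,
  which is the isometry for step functions.\<close>

lemma step_fun_square_integral:
  assumes "partition_01 n t"
  shows "integrable (lebesgue_on {0..1}) (\<lambda>s. (step_fun n t a s)\<^sup>2)"
    and "(\<integral>s. (step_fun n t a s)\<^sup>2 \<partial>lebesgue_on {0..1}) = (\<Sum>i<n. (a i)\<^sup>2 * (t (Suc i) - t i))"
proof -
  have inc: "t i < t (Suc i)" if "i < n" for i
    using assms that by (simp add: partition_01_def)
  have ind: "has_bochner_integral (lebesgue_on {0..1}) (indicator {t i<..t (Suc i)} :: real \<Rightarrow> real) (t (Suc i) - t i)"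
    if "i < n" for i
  proof -
    have sub: "{t i<..t (Suc i)} \<subseteq> {0..1}"
      using partition_01_bounds[OF assms, of i] partition_01_bounds[OF assms, of "Suc i"] that by auto
    have "measure (lebesgue_on {0..1}) {t i<..t (Suc i)} = t (Suc i) - t i"
      using sub inc[OF that] by (simp add: measure_restrict_space)
    moreover have "has_bochner_integral (lebesgue_on {0..1}) (indicator {t i<..t (Suc i)} :: real \<Rightarrow> real)
        (measure (lebesgue_on {0..1}) {t i<..t (Suc i)})"
      using sub inc[OF that] by (intro has_bochner_integral_real_indicator)
        (auto simp: sets_restrict_space_iff emeasure_restrict_space)
    ultimately show ?thesis by simp
  qed
  have sq: "(step_fun n t a s)\<^sup>2 = (\<Sum>i<n. (a i)\<^sup>2 * indicator {t i<..t (Suc i)} s)" for s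
    using inc by (rule step_fun_squared)
  have "has_bochner_integral (lebesgue_on {0..1}) (\<lambda>s. (step_fun n t a s)\<^sup>2)
      (\<Sum>i<n. (a i)\<^sup>2 * (t (Suc i) - t i))"
    unfolding sq by (intro has_bochner_integral_sum has_bochner_integral_mult_right) (auto intro: ind)
  then show "integrable (lebesgue_on {0..1}) (\<lambda>s. (step_fun n t a s)\<^sup>2)"
    and "(\<integral>s. (step_fun n t a s)\<^sup>2 \<partial>lebesgue_on {0..1}) = (\<Sum>i<n. (a i)\<^sup>2 * (t (Suc i) - t i))"
    by (auto simp: has_bochner_integral_iff)
qed

text \<open>
  A pair \<open>(c, r)\<close> stands for the step function \<open>c\<close> on \<open>(0, r]\<close>. With lists of such pairs, sums of
  step functions are concatenations, and no common refinement of partitions is needed.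
\<close>

definition list_fun :: "(real \<times> real) list \<Rightarrow> real \<Rightarrow> real"
  where "list_fun L s = (\<Sum>(c, r)\<leftarrow>L. c * indicator {0<..r} s)"

definition list_integral :: "(real \<times> real) list \<Rightarrow> wpath \<Rightarrow> real"
  where "list_integral L w = (\<Sum>(c, r)\<leftarrow>L. c * ev w r)"

text \<open>The interval (p, q] is (0, q] without (0, p], so each step yields two pairs with
  opposite coefficients.\<close>

lemma step_eq_list:
  assumes "partition_01 n t"
  obtains L where "snd ` set L \<subseteq> {0..1}"
    "list_fun L = step_fun n t a" "list_integral L = step_integral n t a"
proof
  define L where "L m = concat (map (\<lambda>i. [(a i, t (Suc i)), (- a i, t i)]) [0..<m])" for m
  have L: "list_fun (L m) s = step_fun m t a s \<and> list_integral (L m) w = step_integral m t a w"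
    if "m \<le> n" for m s w
    using that
  proof (induction m)
    case (Suc m)
    have "0 \<le> t m" "t m < t (Suc m)"
      using assms Suc.prems partition_01_bounds[OF assms, of m] by (auto simp: partition_01_def)
    then have "a m * indicator {t m<..t (Suc m)} s = a m * indicator {0<..t (Suc m)} s - a m * indicator {0<..t m} s"
      by (auto simp: indicator_def)
    with Suc show ?case
      by (simp add: L_def list_fun_def list_integral_def step_fun_def step_integral_def algebra_simps)
  qed (simp add: L_def list_fun_def list_integral_def step_fun_def step_integral_def)
  show "list_fun (L n) = step_fun n t a" "list_integral (L n) = step_integral n t a"
    using L[of n] by auto
  show "snd ` set (L n) \<subseteq> {0..1}"
    using partition_01_bounds[OF assms] by (auto simp: L_def)
qed

text \<open>The way back to disjoint intervals, where independence of increments applies. The grid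
  consists of the sorted endpoints; the value on the interval starting at \<open>t i\<close> is the
  sum of all \<open>c\<close> whose \<open>r\<close> lies beyond \<open>t i\<close>.\<close>

lemma list_eq_step:
  assumes "snd ` set L \<subseteq> {0..1}"
  obtains n t a where "partition_01 n t"
    "list_fun L = step_fun n t a" "list_integral L = step_integral n t a"
proof -
  \<comment> \<open>Inserting 0 makes the grid start at 0, so that the intervals up to
    \<open>t k\<close> fill (0, \<open>t k\<close>] and the increments telescope to
    \<open>ev w (t k)\<close>.\<close>
  define T where "T = insert 0 (snd ` set L)"
  define t where "t i = sorted_list_of_set T ! i" for i
  define n where "n = card T - 1"
  have T: "finite T" "T \<subseteq> {0..1}"
    using assms by (auto simp: T_def)
  then have card: "card T = Suc n"
    by (simp add: n_def T_def card_gt_0_iff)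
  have t_in: "t i \<in> T" if "i \<le> n" for i
    using that T card nth_mem[of i "sorted_list_of_set T"] by (simp add: t_def)
  have mono: "t i < t j" if "i < j" "j \<le> n" for i j
    unfolding t_def using that T card by (intro sorted_wrt_nth_less[of "(<)"]) auto
  have ex: "\<exists>k\<le>n. r = t k" if "r \<in> T" for r
    using that T card in_set_conv_nth[of r "sorted_list_of_set T"]
    by (auto simp: t_def less_Suc_eq_le)
  obtain k where k: "k \<le> n" "0 = t k"
    using ex[of 0] by (auto simp: T_def)
  have t0: "t 0 = 0"
    using mono[of 0 k] k t_in[of 0] T(2) by (cases "k = 0") auto
  have part: "partition_01 n t"
    using t_in[of 0] t_in[of n] T(2) mono by (auto simp: partition_01_def)
  \<comment> \<open>The grid stays that of \<open>L\<close> while the induction runs over lists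
    \<open>L'\<close> with entries from \<open>L\<close>.\<close>
  have "list_fun L' s = step_fun n t (\<lambda>i. \<Sum>(c, r)\<leftarrow>L'. if t i < r then c else 0) s \<and>
      list_integral L' w = step_integral n t (\<lambda>i. \<Sum>(c, r)\<leftarrow>L'. if t i < r then c else 0) w"
    if "set L' \<subseteq> set L" for L' s w
    using that
  proof (induction L')
    case (Cons cr L')
    obtain c r where cr: "cr = (c, r)" by force
    then have "r \<in> T"
      using Cons.prems by (force simp: T_def)
    then obtain k where k: "k \<le> n" "r = t k"
      using ex by blast
    have less: "t i < t k \<longleftrightarrow> i < k" if "i < n" for i
      using mono[of i k] mono[of k i] that k(1) by (cases i k rule: linorder_cases) auto
    \<comment> \<open>A pair \<open>(c, t k)\<close> contributes the constant \<open>c\<close> on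
      exactly the first \<open>k\<close> intervals.\<close>
    have sub: "(\<Sum>i<n. (if t i < t k then c else 0) * y i) = (\<Sum>i<k. c * y i)" for y
    proof -
      have "(\<Sum>i<n. (if t i < t k then c else 0) * y i) = (\<Sum>i<n. if i < k then c * y i else 0)"
        using less by (intro sum.cong) auto
      also have "\<dots> = (\<Sum>i\<in>{..<n} \<inter> {i. i < k}. c * y i)"
        by (subst sum.inter_restrict) auto
      also have "{..<n} \<inter> {i. i < k} = {..<k}"
        using k by auto
      finally show ?thesis .
    qed
    have ind: "(\<Sum>i<m. indicator {t i<..t (Suc i)} s) = (indicator {0<..t m} s :: real)" if "m \<le> n" for m
      using that
    proof (induction m)
      case (Suc m)
      have "0 \<le> t m" "t m < t (Suc m)"
        using Suc.prems t_in[of m] T(2) mono by auto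
      with Suc show ?case
        by (auto simp: indicator_def)
    qed (simp add: t0)
    have incr: "(\<Sum>i<k. ev w (t (Suc i)) - ev w (t i)) = ev w (t k)"
      using sum_lessThan_telescope[of "\<lambda>i. ev w (t i)" k] by (simp add: t0 ev_0)
    show ?case
      using Cons sub ind[OF k(1)] incr
      by (simp add: cr k(2) list_fun_def list_integral_def step_fun_def step_integral_def
          distrib_right sum.distrib sum_distrib_left[symmetric])
  qed (simp add: list_fun_def list_integral_def step_fun_def step_integral_def)
  from this[of L] part show ?thesis
    by (intro that[of n t]) auto
qed

lemma list_fun_append: "list_fun (L @ L') s = list_fun L s + list_fun L' s"
  and list_integral_append: "list_integral (L @ L') w = list_integral L w + list_integral L' w"
  by (simp_all add: list_fun_def list_integral_def)

lemma list_fun_scale: "list_fun (map (apfst ((*) c)) L) s = c * list_fun L s"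
  and list_integral_scale: "list_integral (map (apfst ((*) c)) L) w = c * list_integral L w"
  by (induction L) (auto simp: list_fun_def list_integral_def algebra_simps)

section \<open>Mean square convergence\<close>

text \<open>First \<epsilon> is fixed to make the first term small, then \<open>k\<close> is taken
  large; \<open>K \<epsilon>\<close> may blow up as \<epsilon> tends to 0.\<close>

lemma tendsto_ennreal_bound:
  fixes a :: "nat \<Rightarrow> 'a::real_normed_vector"
  assumes d: "d \<longlonglongrightarrow> (0::ennreal)" and C: "0 \<le> C"
    and le: "\<And>\<epsilon> k. 0 < \<epsilon> \<Longrightarrow> ennreal (norm (a k - l)) \<le> ennreal (C * \<epsilon>) + ennreal (K \<epsilon>) * d k"
  shows "a \<longlonglongrightarrow> l"
proof (rule metric_LIMSEQ_I)
  fix e :: real assume "0 < e"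
  \<comment> \<open>Dividing by \<open>C + 1\<close> also covers \<open>C = 0\<close>.\<close>
  define \<epsilon> where "\<epsilon> = e / (C + 1)"
  have "0 < \<epsilon>" "C * \<epsilon> < e"
    using \<open>0 < e\<close> C by (auto simp: \<epsilon>_def field_simps)
  have "(\<lambda>k. ennreal (C * \<epsilon>) + ennreal (K \<epsilon>) * d k) \<longlonglongrightarrow> ennreal (C * \<epsilon>) + ennreal (K \<epsilon>) * 0"
    by (intro tendsto_intros ennreal_tendsto_cmult d) auto
  then have "\<forall>\<^sub>F k in sequentially. ennreal (C * \<epsilon>) + ennreal (K \<epsilon>) * d k < ennreal e"
    using \<open>C * \<epsilon> < e\<close> \<open>0 < e\<close> by (intro order_tendstoD) (auto simp: ennreal_less_iff C \<open>0 < \<epsilon>\<close> less_imp_le)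
  then have "\<forall>\<^sub>F k in sequentially. dist (a k) l < e"
  proof eventually_elim
    case (elim k)
    with le[OF \<open>0 < \<epsilon>\<close>, of k] have "ennreal (norm (a k - l)) < ennreal e"
      by (rule le_less_trans)
    then show ?case
      by (simp add: dist_norm ennreal_less_iff)
  qed
  then show "\<exists>no. \<forall>n\<ge>no. dist (a n) l < e"
    by (simp add: eventually_sequentially)
qed

text \<open>The nonnegative integral is infinite for differences that are not square integrable,
  where the Bochner integral would default to 0. The form matches
  \<open>is_wiener_integral\<close>.\<close>

definition l2_tendsto :: "'a measure \<Rightarrow> (nat \<Rightarrow> 'a \<Rightarrow> real) \<Rightarrow> ('a \<Rightarrow> real) \<Rightarrow> bool"
  where "l2_tendsto M F f \<longleftrightarrow> (\<lambda>k. \<integral>\<^sup>+x. ennreal ((f x - F k x)\<^sup>2) \<partial>M) \<longlonglongrightarrow> 0"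

lemma ennreal_le_lincomb:
  assumes "x \<le> a * p + b * q" "0 \<le> a" "0 \<le> p" "0 \<le> b" "0 \<le> q"
  shows "ennreal x \<le> ennreal a * ennreal p + ennreal b * ennreal q"
  using assms by (simp add: ennreal_mult[symmetric] ennreal_plus[symmetric] ennreal_leI del: ennreal_plus)

lemma l2_tendsto_add:
  assumes [measurable]: "f \<in> borel_measurable M" "g \<in> borel_measurable M"
      "\<And>k. F k \<in> borel_measurable M" "\<And>k. G k \<in> borel_measurable M"
    and F: "l2_tendsto M F f" and G: "l2_tendsto M G g"
  shows "l2_tendsto M (\<lambda>k x. F k x + G k x) (\<lambda>x. f x + g x)"
  unfolding l2_tendsto_def
proof (rule tendsto_sandwich[OF _ _ tendsto_const])
  let ?b = "\<lambda>k. ennreal 2 * (\<integral>\<^sup>+x. ennreal ((f x - F k x)\<^sup>2) \<partial>M) + ennreal 2 * (\<integral>\<^sup>+x. ennreal ((g x - G k x)\<^sup>2) \<partial>M)"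
  have "?b \<longlonglongrightarrow> ennreal 2 * 0 + ennreal 2 * 0"
    using F G unfolding l2_tendsto_def by (intro tendsto_add ennreal_tendsto_cmult) auto
  then show "?b \<longlonglongrightarrow> 0" by simp
  show "\<forall>\<^sub>F k in sequentially. (\<integral>\<^sup>+x. ennreal ((f x + g x - (F k x + G k x))\<^sup>2) \<partial>M) \<le> ?b k"
  proof (rule always_eventually, rule allI)
    fix k
    have "(p + q)\<^sup>2 \<le> 2 * p\<^sup>2 + 2 * q\<^sup>2" for p q :: real
      using zero_le_power2[of "p - q"] by (simp add: power2_eq_square algebra_simps)
    from this[of "f _ - F k _" "g _ - G k _"]
    have "(\<integral>\<^sup>+x. ennreal ((f x + g x - (F k x + G k x))\<^sup>2) \<partial>M) \<le>
        (\<integral>\<^sup>+x. ennreal 2 * ennreal ((f x - F k x)\<^sup>2) + ennreal 2 * ennreal ((g x - G k x)\<^sup>2) \<partial>M)"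
      by (intro nn_integral_mono ennreal_le_lincomb) (simp_all add: add_diff_add)
    also have "\<dots> = ?b k"
      by (simp add: nn_integral_add nn_integral_cmult)
    finally show "(\<integral>\<^sup>+x. ennreal ((f x + g x - (F k x + G k x))\<^sup>2) \<partial>M) \<le> ?b k" .
  qed
qed simp

lemma l2_tendsto_scale:
  assumes [measurable]: "f \<in> borel_measurable M" "\<And>k. F k \<in> borel_measurable M"
    and F: "l2_tendsto M F f"
  shows "l2_tendsto M (\<lambda>k x. c * F k x) (\<lambda>x. c * f x)"
proof -
  have eq: "ennreal ((c * f x - c * F k x)\<^sup>2) = ennreal (c\<^sup>2) * ennreal ((f x - F k x)\<^sup>2)" for k x
    by (simp add: right_diff_distrib[symmetric] power_mult_distrib ennreal_mult)
  have "(\<lambda>k. ennreal (c\<^sup>2) * (\<integral>\<^sup>+x. ennreal ((f x - F k x)\<^sup>2) \<partial>M)) \<longlonglongrightarrow> ennreal (c\<^sup>2) * 0"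
    using F unfolding l2_tendsto_def by (intro ennreal_tendsto_cmult) auto
  then show ?thesis
    by (simp add: l2_tendsto_def eq nn_integral_cmult)
qed

text \<open>Convergence of the squared norms. A weighted arithmetic-geometric inequality splits the
  error into \<epsilon> times the squared norm of \<open>f\<close> and a multiple of the squared
  distance, as \<open>tendsto_ennreal_bound\<close> requires.\<close>

lemma l2_tendsto_square_integral:
  assumes [measurable]: "f \<in> borel_measurable M" "\<And>k. F k \<in> borel_measurable M"
    and f: "integrable M (\<lambda>x. (f x)\<^sup>2)" and Fi: "\<And>k. integrable M (\<lambda>x. (F k x)\<^sup>2)"
    and F: "l2_tendsto M F f"
  shows "(\<lambda>k. \<integral>x. (F k x)\<^sup>2 \<partial>M) \<longlonglongrightarrow> (\<integral>x. (f x)\<^sup>2 \<partial>M)"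
proof (rule tendsto_ennreal_bound)
  show "(\<lambda>k. \<integral>\<^sup>+x. ennreal ((f x - F k x)\<^sup>2) \<partial>M) \<longlonglongrightarrow> 0"
    using F by (simp add: l2_tendsto_def)
  show "0 \<le> (\<integral>x. (f x)\<^sup>2 \<partial>M)"
    by simp
  fix \<epsilon> :: real and k assume \<epsilon>: "0 < \<epsilon>"
  have le: "\<bar>q\<^sup>2 - p\<^sup>2\<bar> \<le> \<epsilon> * p\<^sup>2 + (1 + 1 / \<epsilon>) * (p - q)\<^sup>2" for p q :: real
  proof -
    have "q\<^sup>2 - p\<^sup>2 = (p - q)\<^sup>2 - 2 * (p * (p - q))"
      by (simp add: power2_eq_square algebra_simps)
    moreover have "2 * \<bar>p * (p - q)\<bar> \<le> \<epsilon> * p\<^sup>2 + 1 / \<epsilon> * (p - q)\<^sup>2"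
    proof -
      have "0 \<le> (\<epsilon> * \<bar>p\<bar> - \<bar>p - q\<bar>)\<^sup>2 / \<epsilon>"
        using \<epsilon> by simp
      also have "\<dots> = \<epsilon> * \<bar>p\<bar>\<^sup>2 + 1 / \<epsilon> * \<bar>p - q\<bar>\<^sup>2 - 2 * (\<bar>p\<bar> * \<bar>p - q\<bar>)"
        using \<epsilon> by (simp add: power2_diff field_simps power2_eq_square)
      finally show ?thesis
        by (simp add: abs_mult)
    qed
    ultimately show ?thesis
      using zero_le_power2[of "p - q"] by (simp only: distrib_right mult_1_left)
  qed
  have "ennreal (norm ((\<integral>x. (F k x)\<^sup>2 \<partial>M) - (\<integral>x. (f x)\<^sup>2 \<partial>M))) = ennreal (norm (\<integral>x. (F k x)\<^sup>2 - (f x)\<^sup>2 \<partial>M))"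
    by (simp add: f Fi)
  also have "\<dots> \<le> (\<integral>\<^sup>+x. ennreal (norm ((F k x)\<^sup>2 - (f x)\<^sup>2)) \<partial>M)"
    by (intro integral_norm_bound_ennreal Bochner_Integration.integrable_diff f Fi)
  also have "\<dots> \<le> (\<integral>\<^sup>+x. ennreal \<epsilon> * ennreal ((f x)\<^sup>2) + ennreal (1 + 1 / \<epsilon>) * ennreal ((f x - F k x)\<^sup>2) \<partial>M)"
    using \<epsilon> by (intro nn_integral_mono ennreal_le_lincomb) (simp_all only: real_norm_def le, simp_all)
  also have "\<dots> = ennreal \<epsilon> * (\<integral>\<^sup>+x. ennreal ((f x)\<^sup>2) \<partial>M) + ennreal (1 + 1 / \<epsilon>) * (\<integral>\<^sup>+x. ennreal ((f x - F k x)\<^sup>2) \<partial>M)"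
    by (simp add: nn_integral_add nn_integral_cmult)
  also have "ennreal \<epsilon> * (\<integral>\<^sup>+x. ennreal ((f x)\<^sup>2) \<partial>M) = ennreal ((\<integral>x. (f x)\<^sup>2 \<partial>M) * \<epsilon>)"
    using \<epsilon> by (simp add: nn_integral_eq_integral f ennreal_mult mult.commute)
  finally show "ennreal (norm ((\<integral>x. (F k x)\<^sup>2 \<partial>M) - (\<integral>x. (f x)\<^sup>2 \<partial>M))) \<le> ennreal ((\<integral>x. (f x)\<^sup>2 \<partial>M) * \<epsilon>) +
      ennreal (1 + 1 / \<epsilon>) * (\<integral>\<^sup>+x. ennreal ((f x - F k x)\<^sup>2) \<partial>M)" .
qed

text \<open>The map \<open>iexp\<close> is 1-Lipschitz, and |p - q| is at most \<epsilon> + (p -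
  q)^2 / \<epsilon>, whether or not it exceeds \<epsilon>. Since the total mass is 1, the constant
  term integrates to itself.\<close>

lemma (in prob_space) l2_tendsto_char:
  assumes [measurable]: "X \<in> borel_measurable M" "\<And>k. S k \<in> borel_measurable M"
    and S: "l2_tendsto M S X"
  shows "(\<lambda>k. \<integral>x. iexp (t * S k x) \<partial>M) \<longlonglongrightarrow> (\<integral>x. iexp (t * X x) \<partial>M)"
proof (rule tendsto_ennreal_bound)
  show "(\<lambda>k. \<integral>\<^sup>+x. ennreal ((X x - S k x)\<^sup>2) \<partial>M) \<longlonglongrightarrow> 0"
    using S by (simp add: l2_tendsto_def)
  show "0 \<le> \<bar>t\<bar>" by simp
  fix \<epsilon> :: real and k assume \<epsilon>: "0 < \<epsilon>"
  have le: "norm (iexp (t * q) - iexp (t * p)) \<le> \<bar>t\<bar> * \<epsilon> + \<bar>t\<bar> / \<epsilon> * (p - q)\<^sup>2" for p q :: real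
  proof -
    have "iexp (t * q) - iexp (t * p) = iexp (t * p) * (iexp (t * (q - p)) - 1)"
      by (simp add: algebra_simps exp_diff[symmetric] exp_add[symmetric])
    then have "norm (iexp (t * q) - iexp (t * p)) = norm (iexp (t * (q - p)) - 1)"
      by (simp add: norm_mult del: of_real_mult)
    also have "\<dots> \<le> \<bar>t * (q - p)\<bar>"
      using iexp_approx1[of "t * (q - p)" 0] by simp
    also have "\<dots> = \<bar>t\<bar> * \<bar>p - q\<bar>"
      by (simp add: abs_mult abs_minus_commute)
    also have "\<bar>t\<bar> * \<bar>p - q\<bar> \<le> \<bar>t\<bar> * (\<epsilon> + 1 / \<epsilon> * (p - q)\<^sup>2)"
    proof (rule mult_left_mono)
      show "\<bar>p - q\<bar> \<le> \<epsilon> + 1 / \<epsilon> * (p - q)\<^sup>2"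
      proof (cases "\<bar>p - q\<bar> \<le> \<epsilon>")
      case False
      then have "\<bar>p - q\<bar> * \<epsilon> \<le> \<bar>p - q\<bar> * \<bar>p - q\<bar>"
        by (intro mult_left_mono) auto
      then have "\<bar>p - q\<bar> \<le> 1 / \<epsilon> * (p - q)\<^sup>2"
        using \<epsilon> by (simp add: field_simps power2_eq_square)
      with \<epsilon> show ?thesis by simp
      qed (use \<epsilon> in \<open>auto intro: add_increasing2\<close>)
    qed simp
    finally show ?thesis
      by (simp add: distrib_left)
  qed
  have int: "integrable M (\<lambda>x. iexp (t * Y x))" if "Y \<in> borel_measurable M" for Y :: "'a \<Rightarrow> real"
    using that by (intro integrable_iexp) auto
  have "ennreal (norm ((\<integral>x. iexp (t * S k x) \<partial>M) - (\<integral>x. iexp (t * X x) \<partial>M))) =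
      ennreal (norm (\<integral>x. iexp (t * S k x) - iexp (t * X x) \<partial>M))"
    by (simp add: int del: of_real_mult)
  also have "\<dots> \<le> (\<integral>\<^sup>+x. ennreal (norm (iexp (t * S k x) - iexp (t * X x))) \<partial>M)"
    by (intro integral_norm_bound_ennreal Bochner_Integration.integrable_diff int) auto
  also have "\<dots> \<le> (\<integral>\<^sup>+x. ennreal (\<bar>t\<bar> * \<epsilon>) + ennreal (\<bar>t\<bar> / \<epsilon>) * ennreal ((X x - S k x)\<^sup>2) \<partial>M)"
    using \<epsilon> le by (intro nn_integral_mono ennreal_le_lincomb[where p = 1, simplified]) simp_all
  also have "\<dots> = ennreal (\<bar>t\<bar> * \<epsilon>) + ennreal (\<bar>t\<bar> / \<epsilon>) * (\<integral>\<^sup>+x. ennreal ((X x - S k x)\<^sup>2) \<partial>M)"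
    by (simp add: nn_integral_add nn_integral_cmult emeasure_space_1)
  finally show "ennreal (norm ((\<integral>x. iexp (t * S k x) \<partial>M) - (\<integral>x. iexp (t * X x) \<partial>M))) \<le>
      ennreal (\<bar>t\<bar> * \<epsilon>) + ennreal (\<bar>t\<bar> / \<epsilon>) * (\<integral>\<^sup>+x. ennreal ((X x - S k x)\<^sup>2) \<partial>M)" .
qed

section \<open>Scaling in the Cameron-Martin space\<close>

lemma abs_continuous_scale:
  assumes "absolutely_continuous_on_01 f"
  shows "absolutely_continuous_on_01 (\<lambda>t. c * f t)"
  unfolding absolutely_continuous_on_01_def
proof (intro allI impI)
  fix \<epsilon> :: real assume "0 < \<epsilon>"
  \<comment> \<open>The summand 1 keeps the denominator positive when \<open>c = 0\<close>.\<close>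
  then have "0 < \<epsilon> / (\<bar>c\<bar> + 1)"
    by simp
  then obtain \<delta> where "\<delta> > 0" and \<delta>: "\<And>n a b. (\<forall>i<n. 0 \<le> a i \<and> a i \<le> b i \<and> b i \<le> (1::real)) \<and>
       disjoint_family_on (\<lambda>i. {a i<..<b i}) {..<n} \<and> (\<Sum>i<(n::nat). b i - a i) < \<delta> \<Longrightarrow>
       (\<Sum>i<n. \<bar>f (b i) - f (a i)\<bar>) < \<epsilon> / (\<bar>c\<bar> + 1)"
    using assms unfolding absolutely_continuous_on_01_def by meson
  show "\<exists>\<delta>>0. \<forall>n a b. (\<forall>i<n. 0 \<le> a i \<and> a i \<le> b i \<and> b i \<le> (1::real)) \<and>
       disjoint_family_on (\<lambda>i. {a i<..<b i}) {..<n} \<and> (\<Sum>i<(n::nat). b i - a i) < \<delta> \<longrightarrow>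
       (\<Sum>i<n. \<bar>c * f (b i) - c * f (a i)\<bar>) < \<epsilon>"
  proof (intro exI[of _ \<delta>] conjI allI impI \<open>\<delta> > 0\<close>)
    fix n :: nat and a b :: "nat \<Rightarrow> real"
    assume "(\<forall>i<n. 0 \<le> a i \<and> a i \<le> b i \<and> b i \<le> 1) \<and>
       disjoint_family_on (\<lambda>i. {a i<..<b i}) {..<n} \<and> (\<Sum>i<n. b i - a i) < \<delta>"
    from \<delta>[OF this] have "(\<bar>c\<bar> + 1) * (\<Sum>i<n. \<bar>f (b i) - f (a i)\<bar>) < \<epsilon>"
      by (simp add: field_simps)
    moreover have "\<bar>c\<bar> * (\<Sum>i<n. \<bar>f (b i) - f (a i)\<bar>) \<le> (\<bar>c\<bar> + 1) * (\<Sum>i<n. \<bar>f (b i) - f (a i)\<bar>)"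
      by (intro mult_right_mono sum_nonneg) auto
    ultimately show "(\<Sum>i<n. \<bar>c * f (b i) - c * f (a i)\<bar>) < \<epsilon>"
      by (simp add: right_diff_distrib[symmetric] abs_mult sum_distrib_left)
  qed
qed

text \<open>Extension by 0 reduces this to completeness of Lebesgue measure on the line.\<close>

lemma borel_measurable_lebesgue_on_AE:
  fixes f g :: "real \<Rightarrow> real"
  assumes f: "f \<in> borel_measurable (lebesgue_on S)" and S: "S \<in> sets lebesgue"
    and ae: "AE x in lebesgue_on S. f x = g x"
  shows "g \<in> borel_measurable (lebesgue_on S)"
proof -
  have "(\<lambda>x. if x \<in> S then f x else 0) \<in> borel_measurable lebesgue"
    using f S by (simp add: borel_measurable_if)
  moreover have "AE x in lebesgue. (if x \<in> S then f x else 0) = (if x \<in> S then g x else 0)"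
    using ae S by (subst (asm) AE_restrict_space_iff) auto
  ultimately have "(\<lambda>x. if x \<in> S then g x else 0) \<in> borel_measurable lebesgue"
    by (rule borel_measurable_AE)
  then show ?thesis
    using S by (simp add: borel_measurable_if)
qed

text \<open>The shift convention covers only Cameron-Martin directions, so differentiating along
  \<theta> needs its multiples there. As \<open>deriv\<close> is arbitrary where the derivative
  fails to exist, the two derivatives are compared only almost everywhere.\<close>

lemma cameron_martin_scale:
  assumes \<theta>: "\<theta> \<in> cameron_martin"
  shows deriv_scale_AE: "AE t in lebesgue_on {0..1}. deriv (ev (s *\<^sub>R \<theta>)) t = s * deriv (ev \<theta>) t"
    and scale_in_cameron_martin: "s *\<^sub>R \<theta> \<in> cameron_martin"
proof -
  have ev: "ev (s *\<^sub>R \<theta>) = (\<lambda>t. s * ev \<theta> t)"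
    by (rule ext) simp
  from \<theta> have ac: "absolutely_continuous_on_01 (ev \<theta>)"
    and diff: "AE t in lebesgue_on {0..1}. ev \<theta> differentiable (at t)"
    and meas: "deriv (ev \<theta>) \<in> borel_measurable (lebesgue_on {0..1})"
    and sq: "integrable (lebesgue_on {0..1}) (\<lambda>t. (deriv (ev \<theta>) t)\<^sup>2)"
    by (auto simp: cameron_martin_def)
  have der: "((\<lambda>t. s * ev \<theta> t) has_field_derivative s * deriv (ev \<theta>) t) (at t)"
    if "ev \<theta> differentiable (at t)" for t
    using that by (intro DERIV_cmult DERIV_deriv_iff_real_differentiable[THEN iffD2])
  show AE: "AE t in lebesgue_on {0..1}. deriv (ev (s *\<^sub>R \<theta>)) t = s * deriv (ev \<theta>) t"
    using diff by eventually_elim (simp only: ev DERIV_imp_deriv[OF der])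
  have meas': "deriv (ev (s *\<^sub>R \<theta>)) \<in> borel_measurable (lebesgue_on {0..1})"
  proof (rule borel_measurable_lebesgue_on_AE)
    show "(\<lambda>t. s * deriv (ev \<theta>) t) \<in> borel_measurable (lebesgue_on {0..1})"
      using meas by (rule borel_measurable_times[OF borel_measurable_const])
    show "AE t in lebesgue_on {0..1}. s * deriv (ev \<theta>) t = deriv (ev (s *\<^sub>R \<theta>)) t"
      using AE by eventually_elim (rule sym)
  qed simp
  have "AE t in lebesgue_on {0..1}. s\<^sup>2 * (deriv (ev \<theta>) t)\<^sup>2 = (deriv (ev (s *\<^sub>R \<theta>)) t)\<^sup>2"
    using AE by eventually_elim (simp add: power_mult_distrib)
  then have "integrable (lebesgue_on {0..1}) (\<lambda>t. (deriv (ev (s *\<^sub>R \<theta>)) t)\<^sup>2)"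
    by (rule integrable_cong_AE_imp[rotated 2]) (use sq meas' in simp_all)
  moreover have "AE t in lebesgue_on {0..1}. ev (s *\<^sub>R \<theta>) differentiable (at t)"
    using diff by eventually_elim (unfold ev real_differentiable_def, blast intro: der[unfolded real_differentiable_def])
  ultimately show "s *\<^sub>R \<theta> \<in> cameron_martin"
    using abs_continuous_scale[OF ac, of s] meas' by (simp add: cameron_martin_def ev)
qed

text \<open>With the shift convention, this makes each bracket affine in s on the line w + s
  \<theta>.\<close>

lemma cm_inner_scale:
  assumes "h \<in> cameron_martin" "\<theta> \<in> cameron_martin"
  shows "cm_inner h (s *\<^sub>R \<theta>) = s * cm_inner h \<theta>"
proof -
  have [measurable]: "deriv (ev k) \<in> borel_measurable (lebesgue_on {0..1})" if "k \<in> cameron_martin" for k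
    using that by (simp add: cameron_martin_def)
  note [measurable] = this[OF assms(1)] this[OF assms(2)] this[OF scale_in_cameron_martin[OF assms(2)]]
  have "cm_inner h (s *\<^sub>R \<theta>) = (\<integral>t. s * (deriv (ev h) t * deriv (ev \<theta>) t) \<partial>lebesgue_on {0..1})"
    unfolding cm_inner_def
  proof (rule integral_cong_AE)
    show "AE t in lebesgue_on {0..1}. deriv (ev h) t * deriv (ev (s *\<^sub>R \<theta>)) t =
        s * (deriv (ev h) t * deriv (ev \<theta>) t)"
      using deriv_scale_AE[OF assms(2), of s] by eventually_elim simp
  qed measurable
  then show ?thesis
    by (simp add: cm_inner_def)
qed

section \<open>Gaussian moment generating functions\<close>

lemma integrable_mult_of_squares:
  fixes f g :: "'a \<Rightarrow> real"
  assumes [measurable]: "f \<in> borel_measurable M" "g \<in> borel_measurable M"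
    and "integrable M (\<lambda>x. (f x)\<^sup>2)" "integrable M (\<lambda>x. (g x)\<^sup>2)"
  shows "integrable M (\<lambda>x. f x * g x)"
proof (rule Bochner_Integration.integrable_bound)
  show "integrable M (\<lambda>x. (f x)\<^sup>2 + (g x)\<^sup>2)"
    using assms by simp
  have "\<bar>p * q\<bar> \<le> p\<^sup>2 + q\<^sup>2" for p q :: real
    using sum_squares_bound[of "\<bar>p\<bar>" "\<bar>q\<bar>"] abs_ge_zero[of "p * q"]
    by (simp only: abs_mult power2_abs mult.assoc)
  then show "AE x in M. norm (f x * g x) \<le> norm ((f x)\<^sup>2 + (g x)\<^sup>2)"
    by (intro AE_I2) simp
qed measurable

text \<open>Completing the square turns the tilted standard normal density into a multiple of the
  density with mean \<open>\<sigma>\<close>.\<close>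

lemma std_normal_mgf:
  "integrable std_normal_distribution (\<lambda>x. exp (\<sigma> * x))"
  "(\<integral>x. exp (\<sigma> * x) \<partial>std_normal_distribution) = exp (\<sigma>\<^sup>2 / 2)"
proof -
  have eq: "std_normal_density x * exp (\<sigma> * x) = exp (\<sigma>\<^sup>2 / 2) * normal_density \<sigma> 1 x" for x
    by (simp add: normal_density_def exp_add[symmetric] power2_eq_square field_simps)
  show "integrable std_normal_distribution (\<lambda>x. exp (\<sigma> * x))"
    by (subst integrable_density) (auto simp: eq)
  show "(\<integral>x. exp (\<sigma> * x) \<partial>std_normal_distribution) = exp (\<sigma>\<^sup>2 / 2)"
    by (subst integral_density) (auto simp: eq)
qed

text \<open>By Levy's uniqueness theorem \<open>X\<close> has the law of \<sigma> times a standard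
  normal variable. Scaling, rather than a density, includes the degenerate case
  \<open>v = 0\<close>.\<close>

lemma (in prob_space) gaussian_mgf:
  assumes [measurable]: "X \<in> borel_measurable M" and "0 \<le> v"
    and char: "\<And>t. (\<integral>x. iexp (t * X x) \<partial>M) = exp (- (t\<^sup>2 * v / 2))"
  shows "integrable M (\<lambda>x. exp (X x))" and "(\<integral>x. exp (X x) \<partial>M) = exp (v / 2)"
proof -
  interpret N: real_distribution std_normal_distribution
    by (rule real_dist_normal_dist)
  define \<sigma> where "\<sigma> = sqrt v"
  have \<sigma>: "\<sigma>\<^sup>2 = v"
    using \<open>0 \<le> v\<close> by (simp add: \<sigma>_def)
  have "distr M borel X = distr std_normal_distribution borel (\<lambda>x. \<sigma> * x)"
  proof (rule Levy_uniqueness)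
    show "real_distribution (distr M borel X)"
      by (rule real_distribution_distr) simp
    show "real_distribution (distr std_normal_distribution borel (\<lambda>x. \<sigma> * x))"
      by (rule N.real_distribution_distr) simp
    have "char (distr std_normal_distribution borel (\<lambda>x. \<sigma> * x)) t = char std_normal_distribution (t * \<sigma>)" for t
      by (simp add: char_def integral_distr mult.assoc)
    also have "\<dots> t = exp (- (t\<^sup>2 * v / 2))" for t
      by (simp add: char_std_normal_distribution power_mult_distrib \<sigma>)
    finally show "char (distr M borel X) = char (distr std_normal_distribution borel (\<lambda>x. \<sigma> * x))"
      using char by (simp add: fun_eq_iff char_def integral_distr)
  qed
  note eq = this
  show "integrable M (\<lambda>x. exp (X x))"
    using std_normal_mgf(1)[of \<sigma>] integrable_distr_eq[of X M borel exp]
      integrable_distr_eq[of "\<lambda>x. \<sigma> * x" std_normal_distribution borel exp]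
    by (simp add: eq)
  show "(\<integral>x. exp (X x) \<partial>M) = exp (v / 2)"
    using std_normal_mgf(2)[of \<sigma>] integral_distr[of X M borel exp]
      integral_distr[of "\<lambda>x. \<sigma> * x" std_normal_distribution borel exp]
    by (simp add: eq \<sigma>)
qed

text \<open>The variable is a \<sigma> times the standardised \<open>Z\<close>; this also allows
  \<open>a = 0\<close>, where no density exists.\<close>

lemma (in prob_space) char_scaled_normal:
  assumes "distributed M lborel Z (normal_density 0 \<sigma>)" "0 < \<sigma>"
  shows "char (distr M borel (\<lambda>x. a * Z x)) t = exp (- (t\<^sup>2 * (a\<^sup>2 * \<sigma>\<^sup>2) / 2))"
proof -
  have std: "distributed M lborel (\<lambda>x. Z x / \<sigma>) std_normal_density"
    using normal_standard_normal_convert[of \<sigma> Z 0] assms by simp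
  have [measurable]: "Z \<in> borel_measurable M"
    using distributed_measurable[OF assms(1)] by simp
  have distr: "distr M borel (\<lambda>x. Z x / \<sigma>) = std_normal_distribution"
    using distributed_distr_eq_density[OF std] by (simp cong: distr_cong)
  have "char (distr M borel (\<lambda>x. a * Z x)) t = char (distr M borel (\<lambda>x. Z x / \<sigma>)) (t * (a * \<sigma>))"
    using \<open>0 < \<sigma>\<close> by (simp add: char_def integral_distr)
  also have "\<dots> = exp (- (t\<^sup>2 * (a\<^sup>2 * \<sigma>\<^sup>2) / 2))"
    unfolding distr by (simp add: char_std_normal_distribution power_mult_distrib)
  finally show ?thesis .
qed

section \<open>Wiener integrals and the Cameron-Martin formula\<close>

lemma list_fun_measurable [measurable]: "list_fun L \<in> borel_measurable (lebesgue_on S)"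
proof -
  have "list_fun L \<in> borel_measurable borel"
  proof (induction L)
    case (Cons cr L)
    have "list_fun (cr # L) = (\<lambda>s. fst cr * indicator {0<..snd cr} s + list_fun L s)"
      by (auto simp: list_fun_def fun_eq_iff split: prod.splits)
    with Cons show ?case by simp
  qed (simp add: list_fun_def[abs_def])
  then show ?thesis
    by (intro measurable_restrict_space1 measurable_completion) simp
qed

text \<open>The pairs (integrand, version of its integral) form a class closed under sums and
  multiples, with \<open>f\<close> any square integrable function. Linearity is taken from the
  approximations because \<open>wiener_bracket\<close> does not require \<open>I\<close> to be
  linear in its first argument.\<close>

definition wiener_limit :: "wpath measure \<Rightarrow> (real \<Rightarrow> real) \<Rightarrow> (wpath \<Rightarrow> real) \<Rightarrow> bool"
  where "wiener_limit \<gamma> f X \<longleftrightarrow>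
    f \<in> borel_measurable (lebesgue_on {0..1}) \<and> integrable (lebesgue_on {0..1}) (\<lambda>s. (f s)\<^sup>2) \<and>
    X \<in> borel_measurable (completion \<gamma>) \<and>
    (\<exists>L. (\<forall>k. snd ` set (L k) \<subseteq> {0..1}) \<and>
      l2_tendsto (lebesgue_on {0..1}) (\<lambda>k. list_fun (L k)) f \<and>
      l2_tendsto (completion \<gamma>) (\<lambda>k. list_integral (L k)) X)"

lemma wiener_limit_measurable: "wiener_limit \<gamma> f X \<Longrightarrow> X \<in> borel_measurable (completion \<gamma>)"
  by (simp add: wiener_limit_def)

context
  fixes \<gamma> :: "wpath measure"
  assumes wiener: "wiener_measure \<gamma>"
begin

interpretation prob_space \<gamma>
  using wiener by (simp add: wiener_measure_def)

interpretation completion: prob_space "completion \<gamma>"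
  by (rule prob_space_completion)

section \<open>The Gaussian law of step integrals\<close>

lemma increment_distributed:
  assumes "partition_01 n t" "i < n"
  shows "distributed \<gamma> lborel (\<lambda>w. ev w (t (Suc i)) - ev w (t i)) (normal_density 0 (sqrt (t (Suc i) - t i)))"
proof -
  have "0 \<le> t i" "t i < t (Suc i)" "t (Suc i) \<le> 1"
    using assms partition_01_bounds[OF assms(1), of i] partition_01_bounds[OF assms(1), of "Suc i"]
    by (auto simp: partition_01_def)
  then show ?thesis
    using wiener by (simp add: wiener_measure_def)
qed

lemma step_integral_measurable:
  assumes "partition_01 n t"
  shows "step_integral n t a \<in> borel_measurable \<gamma>"
proof -
  have "(\<lambda>w. ev w (t (Suc i)) - ev w (t i)) \<in> borel_measurable \<gamma>" if "i < n" for i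
    using distributed_measurable[OF increment_distributed[OF assms that]] by simp
  then show ?thesis
    unfolding step_integral_def[abs_def]
    by (intro borel_measurable_sum borel_measurable_times borel_measurable_const) auto
qed

text \<open>Independence of the increments turns the characteristic function into a product, whose
  exponents add up to the integral of the squared step function.\<close>

lemma step_integral_char:
  assumes "partition_01 n t"
  shows "char (distr \<gamma> borel (step_integral n t a)) x =
    exp (- (x\<^sup>2 * (\<integral>s. (step_fun n t a s)\<^sup>2 \<partial>lebesgue_on {0..1}) / 2))"
proof -
  have "indep_vars (\<lambda>_. borel) (\<lambda>i w. ev w (t (Suc i)) - ev w (t i)) {..<n}"
    using wiener assms by (simp add: wiener_measure_def partition_01_def)
  then have "indep_vars (\<lambda>_. borel) (\<lambda>i w. a i * (ev w (t (Suc i)) - ev w (t i))) {..<n}"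
    by (rule indep_vars_compose2) simp
  then have "char (distr \<gamma> borel (step_integral n t a)) x =
      (\<Prod>i<n. char (distr \<gamma> borel (\<lambda>w. a i * (ev w (t (Suc i)) - ev w (t i)))) x)"
    unfolding step_integral_def[abs_def] by (rule char_distr_sum)
  also have "\<dots> = (\<Prod>i<n. complex_of_real (exp (- (x\<^sup>2 * ((a i)\<^sup>2 * (t (Suc i) - t i)) / 2))))"
  proof (intro prod.cong refl)
    fix i assume "i \<in> {..<n}"
    then have "i < n" "t i < t (Suc i)"
      using assms by (auto simp: partition_01_def)
    with char_scaled_normal[OF increment_distributed[OF assms \<open>i < n\<close>], of "a i" x]
    show "char (distr \<gamma> borel (\<lambda>w. a i * (ev w (t (Suc i)) - ev w (t i)))) x =
        complex_of_real (exp (- (x\<^sup>2 * ((a i)\<^sup>2 * (t (Suc i) - t i)) / 2)))"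
      by simp
  qed
  also have "\<dots> = complex_of_real (exp (\<Sum>i<n. - (x\<^sup>2 * ((a i)\<^sup>2 * (t (Suc i) - t i)) / 2)))"
    by (simp only: exp_sum[OF finite_lessThan] of_real_prod)
  also have "(\<Sum>i<n. - (x\<^sup>2 * ((a i)\<^sup>2 * (t (Suc i) - t i)) / 2)) =
      - (x\<^sup>2 * (\<integral>s. (step_fun n t a s)\<^sup>2 \<partial>lebesgue_on {0..1}) / 2)"
    by (simp only: step_fun_square_integral(2)[OF assms] sum_negf sum_divide_distrib sum_distrib_left)
  finally show ?thesis .
qed

lemma list_integral_gaussian:
  assumes "snd ` set L \<subseteq> {0..1}"
  shows list_integral_measurable: "list_integral L \<in> borel_measurable (completion \<gamma>)"
    and list_fun_square_integrable: "integrable (lebesgue_on {0..1}) (\<lambda>s. (list_fun L s)\<^sup>2)"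
    and list_integral_char: "(\<integral>w. iexp (x * list_integral L w) \<partial>completion \<gamma>) =
      exp (- (x\<^sup>2 * (\<integral>s. (list_fun L s)\<^sup>2 \<partial>lebesgue_on {0..1}) / 2))"
proof -
  obtain n t a where part: "partition_01 n t"
    and eq: "list_fun L = step_fun n t a" "list_integral L = step_integral n t a"
    using list_eq_step[OF assms] by blast
  note meas = step_integral_measurable[OF part, of a]
  show "list_integral L \<in> borel_measurable (completion \<gamma>)"
    unfolding eq by (rule measurable_completion) (rule meas)
  show "integrable (lebesgue_on {0..1}) (\<lambda>s. (list_fun L s)\<^sup>2)"
    unfolding eq by (rule step_fun_square_integral[OF part])
  \<comment> \<open>Step integrals are measurable for \<gamma> itself, so completing the measure
    does not change the expectation.\<close>
  have "(\<integral>w. iexp (x * step_integral n t a w) \<partial>completion \<gamma>) = (\<integral>w. iexp (x * step_integral n t a w) \<partial>\<gamma>)"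
    using meas by (intro integral_completion) measurable
  also have "\<dots> = char (distr \<gamma> borel (step_integral n t a)) x"
    unfolding char_def using meas by (subst integral_distr) auto
  finally show "(\<integral>w. iexp (x * list_integral L w) \<partial>completion \<gamma>) =
      exp (- (x\<^sup>2 * (\<integral>s. (list_fun L s)\<^sup>2 \<partial>lebesgue_on {0..1}) / 2))"
    unfolding eq step_integral_char[OF part] .
qed

section \<open>Linear combinations and moments of Wiener integrals\<close>

lemma wiener_limit_add:
  assumes "wiener_limit \<gamma> f X" "wiener_limit \<gamma> g Y"
  shows "wiener_limit \<gamma> (\<lambda>s. f s + g s) (\<lambda>w. X w + Y w)"
proof -
  obtain L where [measurable]: "f \<in> borel_measurable (lebesgue_on {0..1})" "X \<in> borel_measurable (completion \<gamma>)"
    and f2: "integrable (lebesgue_on {0..1}) (\<lambda>s. (f s)\<^sup>2)"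
    and L: "\<And>k. snd ` set (L k) \<subseteq> {0..1}"
      "l2_tendsto (lebesgue_on {0..1}) (\<lambda>k. list_fun (L k)) f"
      "l2_tendsto (completion \<gamma>) (\<lambda>k. list_integral (L k)) X"
    using assms(1) by (auto simp: wiener_limit_def)
  obtain K where [measurable]: "g \<in> borel_measurable (lebesgue_on {0..1})" "Y \<in> borel_measurable (completion \<gamma>)"
    and g2: "integrable (lebesgue_on {0..1}) (\<lambda>s. (g s)\<^sup>2)"
    and K: "\<And>k. snd ` set (K k) \<subseteq> {0..1}"
      "l2_tendsto (lebesgue_on {0..1}) (\<lambda>k. list_fun (K k)) g"
      "l2_tendsto (completion \<gamma>) (\<lambda>k. list_integral (K k)) Y"
    using assms(2) by (auto simp: wiener_limit_def)
  note [measurable] = list_integral_measurable[OF L(1)] list_integral_measurable[OF K(1)]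
  have "integrable (lebesgue_on {0..1}) (\<lambda>s. (f s + g s)\<^sup>2)"
    unfolding power2_sum mult.assoc using f2 g2
    by (intro Bochner_Integration.integrable_add integrable_mult_right integrable_mult_of_squares) measurable
  moreover have "l2_tendsto (lebesgue_on {0..1}) (\<lambda>k. list_fun (L k @ K k)) (\<lambda>s. f s + g s)"
    unfolding list_fun_append[abs_def] by (rule l2_tendsto_add) (use L K in measurable)
  moreover have "l2_tendsto (completion \<gamma>) (\<lambda>k. list_integral (L k @ K k)) (\<lambda>w. X w + Y w)"
    unfolding list_integral_append[abs_def] by (rule l2_tendsto_add) (use L K in measurable)
  moreover have "\<forall>k. snd ` set (L k @ K k) \<subseteq> {0..1}"
    using L(1) K(1) by (simp add: image_Un)
  ultimately show ?thesis
    unfolding wiener_limit_def by (intro conjI exI[of _ "\<lambda>k. L k @ K k"]) measurable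
qed

lemma wiener_limit_scale:
  assumes "wiener_limit \<gamma> f X"
  shows "wiener_limit \<gamma> (\<lambda>s. c * f s) (\<lambda>w. c * X w)"
proof -
  obtain L where [measurable]: "f \<in> borel_measurable (lebesgue_on {0..1})" "X \<in> borel_measurable (completion \<gamma>)"
    and f2: "integrable (lebesgue_on {0..1}) (\<lambda>s. (f s)\<^sup>2)"
    and L: "\<And>k. snd ` set (L k) \<subseteq> {0..1}"
      "l2_tendsto (lebesgue_on {0..1}) (\<lambda>k. list_fun (L k)) f"
      "l2_tendsto (completion \<gamma>) (\<lambda>k. list_integral (L k)) X"
    using assms by (auto simp: wiener_limit_def)
  note [measurable] = list_integral_measurable[OF L(1)]
  let ?K = "\<lambda>k. map (apfst ((*) c)) (L k)"
  have "integrable (lebesgue_on {0..1}) (\<lambda>s. (c * f s)\<^sup>2)"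
    unfolding power_mult_distrib using f2 by (rule integrable_mult_right)
  moreover have "l2_tendsto (lebesgue_on {0..1}) (\<lambda>k. list_fun (?K k)) (\<lambda>s. c * f s)"
    unfolding list_fun_scale[abs_def] by (rule l2_tendsto_scale) (use L in measurable)
  moreover have "l2_tendsto (completion \<gamma>) (\<lambda>k. list_integral (?K k)) (\<lambda>w. c * X w)"
    unfolding list_integral_scale[abs_def] by (rule l2_tendsto_scale) (use L in measurable)
  moreover have "\<forall>k. snd ` set (?K k) \<subseteq> {0..1}"
    using L(1) by (simp add: image_image)
  ultimately show ?thesis
    unfolding wiener_limit_def by (intro conjI exI[of _ ?K]) measurable
qed

lemma wiener_limit_zero: "wiener_limit \<gamma> (\<lambda>_. 0) (\<lambda>_. 0)"
  unfolding wiener_limit_def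
  by (intro conjI exI[of _ "\<lambda>_. []"]) (simp_all add: l2_tendsto_def list_fun_def list_integral_def)

text \<open>The Gaussian characteristic functions of the approximations converge both to that of
  \<open>X\<close> and to the Gaussian one with variance \<open>\<integral>s. (f s)\<^sup>2\<close>;
  uniqueness of limits makes \<open>X\<close> Gaussian.\<close>

lemma wiener_limit_mgf:
  assumes "wiener_limit \<gamma> f X"
  shows "integrable (completion \<gamma>) (\<lambda>w. exp (X w))"
    and "(\<integral>w. exp (X w) \<partial>completion \<gamma>) = exp ((\<integral>s. (f s)\<^sup>2 \<partial>lebesgue_on {0..1}) / 2)"
proof -
  let ?v = "\<integral>s. (f s)\<^sup>2 \<partial>lebesgue_on {0..1}"
  obtain L where [measurable]: "f \<in> borel_measurable (lebesgue_on {0..1})" "X \<in> borel_measurable (completion \<gamma>)"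
    and f2: "integrable (lebesgue_on {0..1}) (\<lambda>s. (f s)\<^sup>2)"
    and L: "\<And>k. snd ` set (L k) \<subseteq> {0..1}"
      "l2_tendsto (lebesgue_on {0..1}) (\<lambda>k. list_fun (L k)) f"
      "l2_tendsto (completion \<gamma>) (\<lambda>k. list_integral (L k)) X"
    using assms by (auto simp: wiener_limit_def)
  have "(\<lambda>k. \<integral>s. (list_fun (L k) s)\<^sup>2 \<partial>lebesgue_on {0..1}) \<longlonglongrightarrow> ?v"
    by (rule l2_tendsto_square_integral[OF _ _ f2 list_fun_square_integrable[OF L(1)] L(2)]) measurable
  then have lim: "(\<lambda>k. complex_of_real (exp (- (x\<^sup>2 * (\<integral>s. (list_fun (L k) s)\<^sup>2 \<partial>lebesgue_on {0..1}) / 2))))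
      \<longlonglongrightarrow> exp (- (x\<^sup>2 * ?v / 2))" for x
    by (intro tendsto_intros) auto
  have "(\<lambda>k. \<integral>w. iexp (x * list_integral (L k) w) \<partial>completion \<gamma>) \<longlonglongrightarrow> (\<integral>w. iexp (x * X w) \<partial>completion \<gamma>)" for x
    by (rule completion.l2_tendsto_char[OF _ list_integral_measurable[OF L(1)] L(3)]) measurable
  then have "(\<integral>w. iexp (x * X w) \<partial>completion \<gamma>) = exp (- (x\<^sup>2 * ?v / 2))" for x
    unfolding list_integral_char[OF L(1)] using lim by (rule LIMSEQ_unique)
  note mgf = completion.gaussian_mgf[OF _ _ this]
  show "integrable (completion \<gamma>) (\<lambda>w. exp (X w))" "(\<integral>w. exp (X w) \<partial>completion \<gamma>) = exp (?v / 2)"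
    by (rule mgf; simp)+
qed

text \<open>The Cameron-Martin formula with unnormalised density \<open>exp (Y w)\<close>:
  \<open>exp (ip g / 2)\<close> is the expectation of that density, and \<open>exp (ip h)\<close> is
  the effect of the shift on \<open>exp (Z w)\<close>. The auxiliary \<open>Z\<close> is arbitrary
  in the induction, to leave room for perturbing it.\<close>

lemma wiener_limit_shifted_moments:
  fixes m :: "nat \<Rightarrow> nat" and n :: nat
  assumes g: "wiener_limit \<gamma> g Y"
    and X: "\<And>i. i < n \<Longrightarrow> wiener_limit \<gamma> (f i) (X i)"
    and Z: "wiener_limit \<gamma> h Z"
  defines "ip \<equiv> \<lambda>f. \<integral>s. f s * g s \<partial>lebesgue_on {0..1}"
  shows "integrable (completion \<gamma>) (\<lambda>w. (\<Prod>i<n. X i w ^ m i) * exp (Z w + Y w)) \<and>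
    integrable (completion \<gamma>) (\<lambda>w. (\<Prod>i<n. (X i w + ip (f i)) ^ m i) * exp (Z w)) \<and>
    (\<integral>w. (\<Prod>i<n. X i w ^ m i) * exp (Z w + Y w) \<partial>completion \<gamma>) =
      exp (ip h + ip g / 2) * (\<integral>w. (\<Prod>i<n. (X i w + ip (f i)) ^ m i) * exp (Z w) \<partial>completion \<gamma>)"
  using X Z
proof (induction n arbitrary: h Z)
  case 0
  have meas: "k \<in> borel_measurable (lebesgue_on {0..1})" "integrable (lebesgue_on {0..1}) (\<lambda>s. (k s)\<^sup>2)"
    if "wiener_limit \<gamma> k K" for k K
    using that by (auto simp: wiener_limit_def)
  note h = meas[OF 0(2)] and g' = meas[OF g]
  \<comment> \<open>Without factors both sides are moment generating functions; half of the
    additional variance of \<open>Z + Y\<close> is the exponent in the claim.\<close>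
  have sq: "(h s + g s)\<^sup>2 = (h s)\<^sup>2 + 2 * (h s * g s) + g s * g s" for s
    by (simp add: power2_eq_square algebra_simps)
  have "(\<integral>s. (h s + g s)\<^sup>2 \<partial>lebesgue_on {0..1}) = (\<integral>s. (h s)\<^sup>2 \<partial>lebesgue_on {0..1}) + 2 * ip h + ip g"
    unfolding sq ip_def using h g'
    by (simp add: integrable_mult_of_squares)
  then show ?case
    using wiener_limit_mgf[OF wiener_limit_add[OF 0(2) g]] wiener_limit_mgf[OF 0(2)]
    by (simp add: exp_add[symmetric] add_divide_distrib)
next
  case (Suc n)
  define G where "G w = (\<Prod>i<n. X i w ^ m i)" for w
  define H where "H w = (\<Prod>i<n. (X i w + ip (f i)) ^ m i)" for w
  let ?c = "exp (ip h + ip g / 2)"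
  have Xn: "wiener_limit \<gamma> (f n) (X n)"
    using Suc.prems(1) by simp
  have meas: "X i \<in> borel_measurable (completion \<gamma>)" if "i < Suc n" for i
    using Suc.prems(1)[OF that] by (rule wiener_limit_measurable)
  note [measurable] = meas[of n, simplified] wiener_limit_measurable[OF g] wiener_limit_measurable[OF Suc.prems(2)]
  have [measurable]: "G \<in> borel_measurable (completion \<gamma>)" "H \<in> borel_measurable (completion \<gamma>)"
    unfolding G_def[abs_def] H_def[abs_def] using meas
    by (intro borel_measurable_prod borel_measurable_power borel_measurable_add borel_measurable_const; simp)+
  \<comment> \<open>The perturbation to which the induction hypothesis is applied, for every
    \<open>s\<close>.\<close>
  have line: "wiener_limit \<gamma> (\<lambda>t. h t + s * f n t) (\<lambda>w. Z w + s * X n w)" for s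
    by (intro wiener_limit_add wiener_limit_scale Suc.prems(2) Xn)
  have sq: "k \<in> borel_measurable (lebesgue_on {0..1}) \<and> integrable (lebesgue_on {0..1}) (\<lambda>s. (k s)\<^sup>2)"
    if "wiener_limit \<gamma> k K" for k K
    using that by (auto simp: wiener_limit_def)
  have ip: "ip (\<lambda>t. h t + s * f n t) = ip h + s * ip (f n)" for s
    using sq[OF Suc.prems(2)] sq[OF Xn] sq[OF g]
    by (simp add: ip_def distrib_right mult.assoc integrable_mult_of_squares)
  have IH: "integrable (completion \<gamma>) (\<lambda>w. G w * exp (Z w + s * X n w + Y w))"
    "integrable (completion \<gamma>) (\<lambda>w. H w * exp (Z w + s * X n w))"
    "(\<integral>w. G w * exp (Z w + s * X n w + Y w) \<partial>completion \<gamma>) =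
      exp (ip h + s * ip (f n) + ip g / 2) * (\<integral>w. H w * exp (Z w + s * X n w) \<partial>completion \<gamma>)" for s
    using Suc.IH[OF Suc.prems(1) line[of s]] by (auto simp: G_def H_def ip)
  define U where "U w = G w * exp (Z w + Y w)" for w
  define V where "V w = ?c * (H w * exp (Z w))" for w
  have [measurable]: "U \<in> borel_measurable (completion \<gamma>)" "V \<in> borel_measurable (completion \<gamma>)"
    unfolding U_def[abs_def] V_def[abs_def] by measurable
  have U: "U w * exp (s * X n w) = G w * exp (Z w + s * X n w + Y w)" for s w
    by (simp add: U_def exp_add algebra_simps)
  \<comment> \<open>The new factor \<open>exp (s * ip (f n))\<close> from the induction hypothesis
    is exactly the one that turns \<open>X n w\<close> into \<open>X n w + ip (f n)\<close> in the
    exponent.\<close>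
  have V: "V w * exp (s * (X n w + ip (f n))) =
      exp (ip h + s * ip (f n) + ip g / 2) * (H w * exp (Z w + s * X n w))" for s w
    by (simp add: V_def exp_add algebra_simps)
  have U_int: "integrable (completion \<gamma>) (\<lambda>w. U w * exp (s * X n w))" for s
    unfolding U by (rule IH)
  have V_int: "integrable (completion \<gamma>) (\<lambda>w. V w * exp (s * (X n w + ip (f n))))" for s
    unfolding V by (intro integrable_mult_right IH)
  \<comment> \<open>Comparing the coefficients of order \<open>m n\<close> in \<open>s\<close>
    supplies the missing factor of the monomial.\<close>
  have "(\<integral>w. U w * X n w ^ m n \<partial>completion \<gamma>) = (\<integral>w. V w * (X n w + ip (f n)) ^ m n \<partial>completion \<gamma>)"
  proof (rule moments_eqI[OF _ _ _ _ U_int V_int])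
    show "(\<integral>w. U w * exp (s * X n w) \<partial>completion \<gamma>) =
        (\<integral>w. V w * exp (s * (X n w + ip (f n))) \<partial>completion \<gamma>)" for s
      unfolding U V IH(3) by (rule integral_mult_right_zero[symmetric])
  qed measurable
  moreover have "integrable (completion \<gamma>) (\<lambda>w. U w * X n w ^ m n)"
    by (rule integrable_moment[OF _ _ U_int]) measurable
  moreover have "integrable (completion \<gamma>) (\<lambda>w. V w * (X n w + ip (f n)) ^ m n)"
    by (rule integrable_moment[OF _ _ V_int]) measurable
  moreover have "(\<Prod>i<Suc n. X i w ^ m i) * exp (Z w + Y w) = U w * X n w ^ m n" for w
    by (simp add: U_def G_def)
  moreover have "(\<Prod>i<Suc n. (X i w + ip (f i)) ^ m i) * exp (Z w) =
      inverse ?c * (V w * (X n w + ip (f n)) ^ m n)" for w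
    by (simp add: V_def H_def)
  ultimately show ?case
    by (simp only: integral_mult_right_zero) (simp add: integrable_mult_right)
qed

text \<open>Entry into the class: \<open>cameron_martin\<close> supplies measurability and square
  integrability of the derivative, and the approximating partitions become lists by
  \<open>step_eq_list\<close>.\<close>

lemma is_wiener_integral_imp_wiener_limit:
  assumes "h \<in> cameron_martin" and "is_wiener_integral \<gamma> (deriv (ev h)) X"
  shows "wiener_limit \<gamma> (deriv (ev h)) X"
proof -
  obtain n t a where part: "\<And>k. partition_01 (n k) (t k)"
    and lim: "l2_tendsto (lebesgue_on {0..1}) (\<lambda>k. step_fun (n k) (t k) (a k)) (deriv (ev h))"
      "l2_tendsto (completion \<gamma>) (\<lambda>k. step_integral (n k) (t k) (a k)) X"
    using assms(2) by (auto simp: is_wiener_integral_def l2_tendsto_def)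
  have "\<exists>L. snd ` set L \<subseteq> {0..1} \<and> list_fun L = step_fun (n k) (t k) (a k) \<and>
      list_integral L = step_integral (n k) (t k) (a k)" for k
    using step_eq_list[OF part] by metis
  then obtain L where "\<And>k. snd ` set (L k) \<subseteq> {0..1}" "\<And>k. list_fun (L k) = step_fun (n k) (t k) (a k)"
      "\<And>k. list_integral (L k) = step_integral (n k) (t k) (a k)"
    by metis
  then show ?thesis
    using lim assms by (auto simp: wiener_limit_def cameron_martin_def is_wiener_integral_def intro!: exI[of _ L])
qed

end

section \<open>The exponential series and the expectation identity\<close>

theorem corollary2p7:
  fixes \<gamma> :: "wpath measure"
    and I :: "wpath \<Rightarrow> wpath \<Rightarrow> real"
    and \<theta> :: wpath
  assumes "wiener_measure \<gamma>"
    and "wiener_bracket \<gamma> I"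
    and "\<theta> \<in> cameron_martin"
  shows "(\<forall>w. summable (\<lambda>n. 1 / fact n * (Dstar I \<theta> ^^ n) (\<lambda>_. 1) w) \<and>
           exp_Dstar I \<theta> (\<lambda>_. 1) w =
             exp (I \<theta> w - 1 / 2 * (\<integral>t. (deriv (ev \<theta>) t)\<^sup>2 \<partial>lebesgue_on {0..1}))) \<and>
         (\<forall>F\<in>polynomial_functionals I.
           integrable (completion \<gamma>) (exp_D \<theta> F) \<and>
           integrable (completion \<gamma>) (\<lambda>w. F w * exp_Dstar I \<theta> (\<lambda>_. 1) w) \<and>
           (\<integral>w. exp_D \<theta> F w \<partial>completion \<gamma>) =
             (\<integral>w. F w * exp_Dstar I \<theta> (\<lambda>_. 1) w \<partial>completion \<gamma>))"
proof -
  define v where "v = (\<integral>t. (deriv (ev \<theta>) t)\<^sup>2 \<partial>lebesgue_on {0..1})"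
  have v: "cm_inner \<theta> \<theta> = v"
    by (simp add: cm_inner_def v_def power2_eq_square)
  have shift: "I h (w + s *\<^sub>R \<theta>) = I h w + s * cm_inner h \<theta>" if "h \<in> cameron_martin" for h w s
    using assms(2,3) that scale_in_cameron_martin[OF assms(3), of s] cm_inner_scale[OF that assms(3), of s]
    by (simp add: wiener_bracket_def)
  have limit: "wiener_limit \<gamma> (deriv (ev h)) (I h)" if "h \<in> cameron_martin" for h
    using assms(1,2) that by (intro is_wiener_integral_imp_wiener_limit) (auto simp: wiener_bracket_def)
  have "(\<lambda>n. 1 / fact n * (Dstar I \<theta> ^^ n) (\<lambda>_. 1) w) sums exp (I \<theta> w - 1 / 2 * v)" for w
    using Dstar_funpow_1[of I \<theta> v] shift[OF assms(3)] hermite_sums_exp[of v "I \<theta> w"]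
    by (simp add: v)
  then have exp_Dstar: "summable (\<lambda>n. 1 / fact n * (Dstar I \<theta> ^^ n) (\<lambda>_. 1) w)"
    "exp_Dstar I \<theta> (\<lambda>_. 1) w = exp (I \<theta> w - 1 / 2 * v)" for w
    by (simp_all add: exp_Dstar_def sums_iff)
  have "integrable (completion \<gamma>) (exp_D \<theta> F) \<and>
      integrable (completion \<gamma>) (\<lambda>w. F w * exp_Dstar I \<theta> (\<lambda>_. 1) w) \<and>
      (\<integral>w. exp_D \<theta> F w \<partial>completion \<gamma>) = (\<integral>w. F w * exp_Dstar I \<theta> (\<lambda>_. 1) w \<partial>completion \<gamma>)"
    if "F \<in> polynomial_functionals I" for F
  proof -
    from that obtain n p h where p: "p \<in> real_polynomials n" "F = (\<lambda>w. p (\<lambda>i. I (h i) w))"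
      and h: "\<And>i. i < n \<Longrightarrow> h i \<in> cameron_martin"
      unfolding polynomial_functionals_def by blast
    then obtain M :: "(nat \<Rightarrow> nat) set" and c where F: "F = (\<lambda>w. \<Sum>m\<in>M. c m * (\<Prod>i<n. I (h i) w ^ m i))"
      unfolding real_polynomials_def by blast
    let ?\<rho> = "\<lambda>i. cm_inner (h i) \<theta>"
    have line: "F (w + s *\<^sub>R \<theta>) = (\<Sum>m\<in>M. c m * (\<Prod>i<n. (I (h i) w + s * ?\<rho> i) ^ m i))" for w s
      unfolding F using shift[OF h] by (intro sum.cong refl arg_cong2[of _ _ _ _ "(*)"] prod.cong) simp_all
    \<comment> \<open>For fixed \<open>w\<close> each bracket is a linear polynomial in
      \<open>s\<close>, so \<open>exp_D_eq_translation\<close> applies.\<close>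
    have "F (w + s *\<^sub>R \<theta>) = poly (\<Sum>m\<in>M. smult (c m) (\<Prod>i<n. [:I (h i) w, ?\<rho> i:] ^ m i)) s" for w s
      unfolding line by (simp add: poly_sum poly_prod)
    from exp_D_eq_translation[OF this] line[of _ 1]
    have exp_D: "exp_D \<theta> F = (\<lambda>w. \<Sum>m\<in>M. c m * (\<Prod>i<n. (I (h i) w + ?\<rho> i) ^ m i))"
      by (simp add: fun_eq_iff)
    define A where "A m w = (\<Prod>i<n. I (h i) w ^ m i) * exp (I \<theta> w)" for m w
    define B where "B m w = (\<Prod>i<n. (I (h i) w + ?\<rho> i) ^ m i)" for m w
    \<comment> \<open>Here \<open>Y\<close> is the bracket of \<theta> and \<open>Z = 0\<close>, so
      that only the factor \<open>exp (v / 2)\<close> remains.\<close>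
    have mom: "integrable (completion \<gamma>) (A m)" "integrable (completion \<gamma>) (B m)"
      "(\<integral>w. A m w \<partial>completion \<gamma>) = exp (v / 2) * (\<integral>w. B m w \<partial>completion \<gamma>)" for m
      using wiener_limit_shifted_moments[where f = "\<lambda>i. deriv (ev (h i))" and X = "\<lambda>i. I (h i)" and m = m,
          OF assms(1) limit[OF assms(3)] limit[OF h] wiener_limit_zero[OF assms(1)], folded cm_inner_def]
      by (simp_all add: v A_def[abs_def] B_def[abs_def])
    have exp_D_B: "exp_D \<theta> F = (\<lambda>w. \<Sum>m\<in>M. c m * B m w)"
      by (simp add: exp_D B_def)
    \<comment> \<open>The normalisation \<open>exp (- (v / 2))\<close> in the value of the series
      cancels the factor \<open>exp (v / 2)\<close> of \<open>mom\<close>.\<close>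
    have product: "(\<lambda>w. F w * exp_Dstar I \<theta> (\<lambda>_. 1) w) = (\<lambda>w. \<Sum>m\<in>M. c m * (exp (- (v / 2)) * A m w))"
    proof
      fix w
      have "exp_Dstar I \<theta> (\<lambda>_. 1) w = exp (- (v / 2)) * exp (I \<theta> w)"
        by (simp add: exp_Dstar exp_add[symmetric])
      then show "F w * exp_Dstar I \<theta> (\<lambda>_. 1) w = (\<Sum>m\<in>M. c m * (exp (- (v / 2)) * A m w))"
        by (simp add: F A_def sum_distrib_left sum_distrib_right mult_ac)
    qed
    have "(\<integral>w. exp (- (v / 2)) * A m w \<partial>completion \<gamma>) = (\<integral>w. B m w \<partial>completion \<gamma>)" for m
      by (simp add: mom(3) exp_minus)
    then show ?thesis
      unfolding exp_D_B product using mom(1,2) by simp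
  qed
  then show ?thesis
    using exp_Dstar by (simp add: v_def)
qed

end
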